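(* The $k$-Leaf Out-Branching problem can be decided with a randomized algorithm in $O^*(2^{k+s})$ time, where $s$ is the minimum, taken over all spanning out-branchings of the input graph with at least $k$ leaves, of the number of internal vertices with out-degree greater than $1$. The algorithm has a negligible probability of reporting a false negative.
   Context: The $k$-Leaf Out-Branching problem asks, given an $n$-vertex directed graph $G$ (without loops and parallel arcs) and an integer $k$, whether $G$ has a spanning out-branching with at least $k$ leaves. A connected directed graph (connected meaning its underlying undirected graph is connected) is an out-branching if every vertex has in-degree $1$ except a single root with in-degree $0$; spanning means it contains all vertices of $G$. A vertex is internal if it has out-degree at least $1$ in the out-branching, otherwise it is a leaf. $O^*(\cdot)$ suppresses a factor polynomial in the input size; negligible probability means probability tending to zero as $n\to\infty$. *)

theory Defs
  imports
    "HOL-Probability.Probability"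
    "HOL-Library.Discrete_Functions"
    "HOL-Computational_Algebra.Polynomial"
    "Graph_Theory.Graph_Theory"
begin

section \<open>Out-branchings\<close>

definition out_branching :: "('a, 'b) pre_digraph \<Rightarrow> bool" where
  "out_branching T \<longleftrightarrow> connected T \<and>
     (\<exists>r \<in> verts T. in_degree T r = 0 \<and> (\<forall>v \<in> verts T - {r}. in_degree T v = 1))"

definition internal_verts :: "('a, 'b) pre_digraph \<Rightarrow> 'a set" where
  "internal_verts T = {v \<in> verts T. out_degree T v \<ge> 1}"

definition leaves :: "('a, 'b) pre_digraph \<Rightarrow> 'a set" where
  "leaves T = verts T - internal_verts T"

definition k_leaf_out_branchings ::
    "nat \<Rightarrow> ('a, 'b) pre_digraph \<Rightarrow> ('a, 'b) pre_digraph set" where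
  "k_leaf_out_branchings k G =
     {T. spanning T G \<and> out_branching T \<and> k \<le> card (leaves T)}"

definition k_leaf_instance :: "nat \<Rightarrow> ('a, 'b) pre_digraph \<Rightarrow> bool" where
  "k_leaf_instance k G \<longleftrightarrow> k_leaf_out_branchings k G \<noteq> {}"

text \<open>A minimum only if \<^term>\<open>k_leaf_instance k G\<close>; otherwise the value is meaningless.\<close>

definition min_branching :: "nat \<Rightarrow> ('a, 'b) pre_digraph \<Rightarrow> nat" where
  "min_branching k G =
     Inf ((\<lambda>T. card {v \<in> internal_verts T. out_degree T v > 1}) ` k_leaf_out_branchings k G)"


section \<open>Randomized programs with logarithmic cost\<close>

text \<open>
  The machine model is a structured random access machine with fair coin flips: finitely many
  named arrays of natural numbers, indirect addressing, and the logarithmic cost criterion.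
  A scalar variable is cell 0 of an array.
\<close>

type_synonym state = "string \<Rightarrow> nat \<Rightarrow> nat"

datatype binop = Add | Sub | Mul | Div | Mod | Xor | Less | Equal

datatype expr = Const nat | Load string expr | Op binop expr expr

datatype com =
    Skip
  | Store string expr expr
  | Flip string expr
  | Seq com com
  | If expr com com
  | While expr com

text \<open>Length of the binary representation; the number 0 has length 1.\<close>

definition blen :: "nat \<Rightarrow> nat" where
  "blen n = Suc (floor_log n)"

fun apply_op :: "binop \<Rightarrow> nat \<Rightarrow> nat \<Rightarrow> nat" where
  "apply_op Add a b = a + b"
| "apply_op Sub a b = a - b"
| "apply_op Mul a b = a * b"
| "apply_op Div a b = a div b"
| "apply_op Mod a b = a mod b"
| "apply_op Xor a b = Bit_Operations.xor a b"
| "apply_op Less a b = of_bool (a < b)"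
| "apply_op Equal a b = of_bool (a = b)"

fun val :: "expr \<Rightarrow> state \<Rightarrow> nat" where
  "val (Const m) \<sigma> = m"
| "val (Load a e) \<sigma> = \<sigma> a (val e \<sigma>)"
| "val (Op f d e) \<sigma> = apply_op f (val d \<sigma>) (val e \<sigma>)"

text \<open>
  An arithmetic operation is charged the product of the lengths of its operands, the bit
  complexity of schoolbook multiplication and division. A memory access is charged the lengths
  of both the address and the content.
\<close>

fun cost :: "expr \<Rightarrow> state \<Rightarrow> nat" where
  "cost (Const m) \<sigma> = blen m"
| "cost (Load a e) \<sigma> = cost e \<sigma> + blen (val e \<sigma>) + blen (\<sigma> a (val e \<sigma>))"
| "cost (Op f d e) \<sigma> = cost d \<sigma> + cost e \<sigma> + blen (val d \<sigma>) * blen (val e \<sigma>)"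

definition update :: "state \<Rightarrow> string \<Rightarrow> nat \<Rightarrow> nat \<Rightarrow> state" where
  "update \<sigma> a i x = \<sigma>(a := (\<sigma> a)(i := x))"

definition delay :: "nat \<Rightarrow> (state \<times> nat) pmf \<Rightarrow> (state \<times> nat) pmf" where
  "delay t p = map_pmf (\<lambda>(\<sigma>, u). (\<sigma>, t + u)) p"

text \<open>
  \<open>exec c \<sigma> p\<close>: started in \<open>\<sigma>\<close>, the program \<open>c\<close> halts for every outcome of the coin flips, and
  \<open>p\<close> is the joint distribution of the final state and the running time. Since the relation is
  inductive, there is no such \<open>p\<close> if some sequence of coin flips leads to an infinite run. In the
  sequencing rules \<open>q\<close> assigns to each intermediate state the distribution of the remaining run.
\<close>

inductive exec :: "com \<Rightarrow> state \<Rightarrow> (state \<times> nat) pmf \<Rightarrow> bool" where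
  Skip: "exec Skip \<sigma> (return_pmf (\<sigma>, 1))"
| Store: "exec (Store a d e) \<sigma>
    (return_pmf (update \<sigma> a (val d \<sigma>) (val e \<sigma>),
       cost d \<sigma> + cost e \<sigma> + blen (val d \<sigma>) + blen (val e \<sigma>)))"
| Flip: "exec (Flip a d) \<sigma>
    (map_pmf (\<lambda>b. (update \<sigma> a (val d \<sigma>) (of_bool b), cost d \<sigma> + blen (val d \<sigma>) + 1))
       (bernoulli_pmf (1/2)))"
| Seq: "exec c \<sigma> p \<Longrightarrow> \<forall>x \<in> set_pmf p. exec c' (fst x) (q (fst x)) \<Longrightarrow>
    exec (Seq c c') \<sigma> (bind_pmf p (\<lambda>(\<sigma>', t). delay t (q \<sigma>')))"
| If_true: "val e \<sigma> \<noteq> 0 \<Longrightarrow> exec c \<sigma> p \<Longrightarrow> exec (If e c c') \<sigma> (delay (cost e \<sigma> + 1) p)"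
| If_false: "val e \<sigma> = 0 \<Longrightarrow> exec c' \<sigma> p \<Longrightarrow> exec (If e c c') \<sigma> (delay (cost e \<sigma> + 1) p)"
| While_false: "val e \<sigma> = 0 \<Longrightarrow> exec (While e c) \<sigma> (return_pmf (\<sigma>, cost e \<sigma> + 1))"
| While_true: "val e \<sigma> \<noteq> 0 \<Longrightarrow> exec c \<sigma> p \<Longrightarrow>
    \<forall>x \<in> set_pmf p. exec (While e c) (fst x) (q (fst x)) \<Longrightarrow>
    exec (While e c) \<sigma> (delay (cost e \<sigma> + 1) (bind_pmf p (\<lambda>(\<sigma>', t). delay t (q \<sigma>'))))"

lemma exec_finite_support: "exec c \<sigma> p \<Longrightarrow> finite (set_pmf p)"
  by (induction rule: exec.induct) (simp_all add: delay_def case_prod_beta)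

inductive_cases SkipE: "exec Skip \<sigma> p"
inductive_cases StoreE: "exec (Store a d e) \<sigma> p"
inductive_cases FlipE: "exec (Flip a d) \<sigma> p"
inductive_cases SeqE: "exec (Seq c c') \<sigma> p"
inductive_cases IfE: "exec (If e c c') \<sigma> p"
inductive_cases WhileE: "exec (While e c) \<sigma> p"

lemma exec_deterministic: "exec c \<sigma> p \<Longrightarrow> exec c \<sigma> p' \<Longrightarrow> p = p'"
proof (induction arbitrary: p' rule: exec.induct)
  case (Skip \<sigma>)
  then show ?case by (rule SkipE) simp
next
  case (Store a d e \<sigma>)
  then show ?case by (rule StoreE) simp
next
  case (Flip a d \<sigma>)
  then show ?case by (rule FlipE) simp
next
  case (Seq c \<sigma> p c' q)
  from Seq.prems show ?case
  proof (rule SeqE)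
    fix p1 q1
    assume 1: "p' = bind_pmf p1 (\<lambda>(\<sigma>', t). delay t (q1 \<sigma>'))" "exec c \<sigma> p1"
      "\<forall>x \<in> set_pmf p1. exec c' (fst x) (q1 (fst x))"
    have "p = p1" using Seq.IH(1) 1(2) by blast
    moreover have "q (fst x) = q1 (fst x)" if "x \<in> set_pmf p1" for x
      using Seq.IH(2) 1(3) that \<open>p = p1\<close> by blast
    ultimately show ?thesis unfolding 1(1)
      by (intro bind_pmf_cong) (simp_all add: case_prod_beta)
  qed
next
  case (If_true e \<sigma> c p c')
  from If_true.prems show ?case
  proof (rule IfE)
    fix p1
    assume "p' = delay (Suc (cost e \<sigma>)) p1" "exec c \<sigma> p1"
    then show ?thesis using If_true.IH[of p1] by simp
  qed (use If_true.hyps in simp)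
next
  case (If_false e \<sigma> c' p c)
  from If_false.prems show ?case
  proof (rule IfE)
    fix p1
    assume "p' = delay (Suc (cost e \<sigma>)) p1" "exec c' \<sigma> p1"
    then show ?thesis using If_false.IH[of p1] by simp
  qed (use If_false.hyps in simp)
next
  case (While_false e \<sigma> c)
  from While_false.prems show ?case by (rule WhileE) (use While_false in simp_all)
next
  case (While_true e \<sigma> c p q)
  from While_true.prems show ?case
  proof (rule WhileE)
    assume "val e \<sigma> = 0"
    then show ?thesis using While_true.hyps by simp
  next
    fix p1 q1
    assume 1: "p' = delay (Suc (cost e \<sigma>)) (bind_pmf p1 (\<lambda>(\<sigma>', t). delay t (q1 \<sigma>')))" "exec c \<sigma> p1"
      "\<forall>x \<in> set_pmf p1. exec (While e c) (fst x) (q1 (fst x))"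
    have "p = p1" using While_true.IH(1) 1(2) by blast
    moreover have "q (fst x) = q1 (fst x)" if "x \<in> set_pmf p1" for x
      using While_true.IH(2) 1(3) that \<open>p = p1\<close> by blast
    ultimately show ?thesis unfolding 1(1)
      by (simp add: case_prod_beta cong: bind_pmf_cong)
  qed
qed


section \<open>Encoding of the input and of the answer\<close>

text \<open>
  The input is the number \<open>n\<close>, the parameter \<open>k\<close> and the adjacency matrix of a digraph with
  vertices \<open>0, \<dots>, n - 1\<close>, stored row by row. All other memory is initially zero.
\<close>

definition input_state :: "nat \<Rightarrow> nat \<Rightarrow> nat pair_pre_digraph \<Rightarrow> state" where
  "input_state n k G = (\<lambda>_ _. 0)
     (''n'' := (\<lambda>_. 0)(0 := n),
      ''k'' := (\<lambda>_. 0)(0 := k),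
      ''A'' := (\<lambda>i. of_bool (i < n * n \<and> (i div n, i mod n) \<in> parcs G)))"

definition input_size :: "nat \<Rightarrow> nat \<Rightarrow> nat" where
  "input_size n k = n * n + blen n + blen k"

definition answers_yes :: "state \<Rightarrow> bool" where
  "answers_yes \<sigma> \<longleftrightarrow> \<sigma> ''out'' 0 \<noteq> 0"

end

theory Submission
  imports Defs
begin

text \<open>
  Draw a random set \<open>X\<close> of vertices. If some spanning out-branching has at most \<open>|X| - k\<close> arcs with
  tail in \<open>X\<close>, then at least \<open>k\<close> vertices of \<open>X\<close> are leaves of it. Conversely, let \<open>T\<close> be an
  out-branching with at least \<open>k\<close> leaves and \<open>s\<close> vertices of out-degree greater than 1. If \<open>X\<close>
  contains \<open>k\<close> fixed leaves of \<open>T\<close> and none of those \<open>s\<close> vertices, then every vertex of \<open>X\<close> has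
  out-degree at most 1 in \<open>T\<close>, so \<open>T\<close> has at most \<open>|X| - k\<close> arcs with tail in \<open>X\<close>. A uniformly
  random \<open>X\<close> satisfies this with probability at least \<open>1 / 2 ^ (k + s)\<close>, and the sampling is repeated
  until it succeeds, but at most \<open>n * 2 ^ (n + k)\<close> times.

  The least number of arcs with tail in \<open>X\<close> in a spanning out-branching with a given root is a
  minimum-cost arborescence problem with costs 0 and 1. By Fulkerson's duality it equals the number
  of steps of a greedy process: as long as some vertex is not reachable from the root by the arcs
  available so far, choose a strongly connected component that no available arc enters and that
  does not contain the root, and make all arcs entering it available.
\<close>

section \<open>Greedy cuts and spanning out-branchings\<close>

text \<open>The number \<open>s\<close> is not part of the input and occurs only in the analysis.
  This is why attempts are repeated until one succeeds: the time is then itself random, with a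
  geometric tail governed by \<open>2 ^ (k + s)\<close>. The cap is there because the semantics
  admits only programs that halt on every outcome of the coins, while on a no-instance no attempt
  ever succeeds. It costs little: since \<open>s \<le> n\<close>, it is at least
  \<open>n * 2 ^ (k + s)\<close>, so a yes-instance is missed with probability at most
  \<open>exp (- n)\<close>. The same estimate bounds the probability of exceeding the time bound.
  Once \<open>X\<close> is drawn, the check is deterministic. Which component the greedy process
  picks is left open; two inequalities, each valid for every choice, take the place of the min-max
  equality. A terminated process with \<open>m\<close> cuts yields at most \<open>m\<close> paid
  arcs that suffice together with the free ones, and any process, terminated or not, makes at most
  as many cuts as a given out-branching has paid arcs.\<close>

text \<open>
  The greedy process starting from the arcs \<open>S0\<close>, after \<open>m\<close> steps. The component chosen is that of
  \<open>v\<close>; since no available arc enters it, it consists of all vertices from which \<open>v\<close> is reachable.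
\<close>

inductive cut_sequence :: "'a set \<Rightarrow> 'a rel \<Rightarrow> 'a \<Rightarrow> 'a rel \<Rightarrow> 'a rel \<Rightarrow> nat \<Rightarrow> bool"
  for V :: "'a set" and E :: "'a rel" and r :: 'a and S0 :: "'a rel" where
  start: "cut_sequence V E r S0 S0 0"
| cut: "cut_sequence V E r S0 S m \<Longrightarrow> v \<in> V \<Longrightarrow> (r, v) \<notin> S\<^sup>* \<Longrightarrow> \<forall>w. (w, v) \<in> S\<^sup>* \<longrightarrow> (v, w) \<in> S\<^sup>* \<Longrightarrow>
    cut_sequence V E r S0
      (S\<^sup>* \<union> {(a, b). (a, b) \<in> E \<and> (a, v) \<notin> S\<^sup>* \<and> (b, v) \<in> S\<^sup>*}) (Suc m)"

text \<open>A path from outside \<open>C\<close> into \<open>C\<close> is split at its first arc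
  into \<open>C\<close>. That all earlier arcs have heads outside \<open>C\<close> is what lets the
  prefix survive when arcs entering \<open>C\<close> are removed.\<close>

lemma first_entry:
  assumes "(r, w) \<in> Q\<^sup>*" "r \<notin> C" "w \<in> C"
  obtains a b where "(r, a) \<in> (Q \<inter> {(x, y). y \<notin> C})\<^sup>*" "a \<notin> C" "b \<in> C" "(a, b) \<in> Q"
proof -
  define P where "P = Q \<inter> {(x, y). y \<notin> C}"
  have "w \<notin> C \<and> (r, w) \<in> P\<^sup>* \<or> (\<exists>a b. (r, a) \<in> P\<^sup>* \<and> a \<notin> C \<and> b \<in> C \<and> (a, b) \<in> Q)"
    using assms(1)
  proof (induction rule: rtrancl_induct)
    case base
    then show ?case using assms(2) by simp
  next
    case (step y z)
    show ?case
    proof (cases "y \<notin> C \<and> (r, y) \<in> P\<^sup>* \<and> z \<notin> C")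
      case True
      then have "(y, z) \<in> P" using step.hyps by (simp add: P_def)
      then have "(r, z) \<in> P\<^sup>*" using True by (meson rtrancl_into_rtrancl)
      then show ?thesis using True by blast
    next
      case False
      then show ?thesis using step.hyps step.IH by blast
    qed
  qed
  then show ?thesis using assms(3) that unfolding P_def by blast
qed

text \<open>
  Undoing the steps in reverse order, one entering arc per component suffices: it gives access to
  one vertex, hence to the whole component, and no path needs to enter the component twice.
\<close>

lemma cut_sequence_select:
  assumes "cut_sequence V E r S0 S m" "finite F" "F \<subseteq> E" "\<forall>w \<in> V. (r, w) \<in> (S \<union> F)\<^sup>*"
  shows "\<exists>F'. finite F' \<and> F' \<subseteq> E \<and> card F' \<le> card F + m \<and> (\<forall>w \<in> V. (r, w) \<in> (S0 \<union> F')\<^sup>*)"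
  using assms
proof (induction arbitrary: F rule: cut_sequence.induct)
  case start
  then show ?case by auto
next
  case (cut S m v)
  define C where "C = {w. (w, v) \<in> S\<^sup>*}"
  define D where "D = {(a, b). (a, b) \<in> E \<and> (a, v) \<notin> S\<^sup>* \<and> (b, v) \<in> S\<^sup>*}"
  have reach: "(r, w) \<in> (S\<^sup>* \<union> D \<union> F)\<^sup>*" if "w \<in> V" for w
    using cut.prems(3) that by (simp add: D_def Un_assoc)
  have D_C: "b \<in> C" "a \<notin> C" "(a, b) \<in> E" if "(a, b) \<in> D" for a b
    using that by (auto simp: D_def C_def)
  \<comment> \<open>By the choice of \<open>v\<close>, everything that reaches \<open>v\<close> is
    reached from \<open>v\<close>; hence \<open>C\<close> is strongly connected in
    \<open>S\<close>.\<close>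
  have scc: "(x, y) \<in> S\<^sup>*" if "x \<in> C" "y \<in> C" for x y
  proof -
    have "(x, v) \<in> S\<^sup>*" "(v, y) \<in> S\<^sup>*" using that cut.hyps unfolding C_def by blast+
    then show ?thesis by (rule rtrancl_trans)
  qed
  have closed: "x \<in> C" if "(x, y) \<in> S\<^sup>*" "y \<in> C" for x y
    using that rtrancl_trans[of x y S v] by (simp add: C_def)
  have "r \<notin> C" using cut.hyps by (simp add: C_def)
  obtain F' where F': "finite F'" "F' \<subseteq> E" "card F' \<le> Suc (card F)"
    "\<forall>w \<in> V. (r, w) \<in> (S \<union> F')\<^sup>*"
  proof (cases "\<exists>w \<in> C. (r, w) \<in> (S\<^sup>* \<union> D \<union> F)\<^sup>*")
    case False
    have "(r, w) \<in> (S \<union> F)\<^sup>*" if "(r, w) \<in> (S\<^sup>* \<union> D \<union> F)\<^sup>*" for w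
      using that
    proof (induction rule: rtrancl_induct)
      case (step y z)
      have "z \<notin> C" using False step.hyps by (meson rtrancl_into_rtrancl)
      then have "(y, z) \<in> S\<^sup>* \<union> F" using step.hyps(2) D_C by blast
      then have "(y, z) \<in> (S \<union> F)\<^sup>*" by (meson Un_iff in_rtrancl_UnI r_into_rtrancl)
      then show ?case using step.IH by simp
    qed simp
    then show ?thesis using that[of F] cut.prems reach by auto
  next
    case True
    then obtain w where w: "w \<in> C" "(r, w) \<in> (S\<^sup>* \<union> D \<union> F)\<^sup>*" by blast
    obtain a b where ab: "(r, a) \<in> ((S\<^sup>* \<union> D \<union> F) \<inter> {(x, y). y \<notin> C})\<^sup>*" "a \<notin> C" "b \<in> C"
      "(a, b) \<in> S\<^sup>* \<union> D \<union> F"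
      using first_entry[OF w(2) \<open>r \<notin> C\<close> w(1)] by blast
    have "(a, b) \<notin> S\<^sup>*" using ab closed by blast
    then have abE: "(a, b) \<in> E" using ab(4) D_C cut.prems(2) by blast
    \<comment> \<open>The arc \<open>(a, b)\<close> stands for the whole cut \<open>D\<close>. The
      path to \<open>a\<close> has all heads outside \<open>C\<close>, so it uses no arc of
      \<open>D\<close> and remains available.\<close>
    define F' where "F' = insert (a, b) F"
    have sub: "S\<^sup>* \<union> F' \<subseteq> (S \<union> F')\<^sup>*" by (auto intro: in_rtrancl_UnI)
    have "(S\<^sup>* \<union> D \<union> F) \<inter> {(x, y). y \<notin> C} \<subseteq> (S \<union> F')\<^sup>*"
      using D_C sub by (auto simp: F'_def)
    then have "(r, a) \<in> (S \<union> F')\<^sup>*"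
      using ab(1) by (metis rtrancl_mono rtrancl_idemp subsetD)
    moreover have "(a, b) \<in> (S \<union> F')\<^sup>*" using sub by (auto simp: F'_def)
    ultimately have rb: "(r, b) \<in> (S \<union> F')\<^sup>*" by simp
    have "(r, w) \<in> (S \<union> F')\<^sup>*" if "(r, w) \<in> (S\<^sup>* \<union> D \<union> F)\<^sup>*" for w
      using that
    proof (induction rule: rtrancl_induct)
      case (step y z)
      show ?case
      \<comment> \<open>Vertices of \<open>C\<close> are reached through \<open>b\<close> inside the
        component, wherever the old path entered. An arc with head outside \<open>C\<close> is not
        in \<open>D\<close> and is kept.\<close>
      proof (cases "z \<in> C")
        case True
        then have "(b, z) \<in> (S \<union> F')\<^sup>*" using scc ab(3) sub by blast
        then show ?thesis using rb by simp
      next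
        case False
        then have "(y, z) \<in> (S \<union> F')\<^sup>*" using step.hyps(2) D_C sub by (auto simp: F'_def)
        then show ?thesis using step.IH by simp
      qed
    qed simp
    moreover have "card F' \<le> Suc (card F)" "finite F'" "F' \<subseteq> E"
      using cut.prems abE by (auto simp: F'_def card_insert_if)
    ultimately show ?thesis using that[of F'] reach by blast
  qed
  from cut.IH[OF F'(1,2,4)] obtain F'' where
    "finite F''" "F'' \<subseteq> E" "card F'' \<le> card F' + m" "\<forall>w \<in> V. (r, w) \<in> (S0 \<union> F'')\<^sup>*" by blast
  then show ?case using F'(3) by (intro exI[of _ F'']) auto
qed

text \<open>
  The arc sets made available in the individual steps are disjoint, and \<open>T\<close> must use each of them.
\<close>

lemma cut_sequence_le_card:
  assumes "cut_sequence V E r S0 S m" "finite T" "T \<subseteq> E" "\<And>w. w \<in> V \<Longrightarrow> (r, w) \<in> T\<^sup>*"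
  shows "S0 \<subseteq> S \<and> m \<le> card (T \<inter> S - S0)"
  using assms(1)
proof (induction rule: cut_sequence.induct)
  case start
  then show ?case by auto
next
  case (cut S m v)
  define C where "C = {w. (w, v) \<in> S\<^sup>*}"
  define S' where "S' = S\<^sup>* \<union> {(a, b). (a, b) \<in> E \<and> (a, v) \<notin> S\<^sup>* \<and> (b, v) \<in> S\<^sup>*}"
  have "v \<in> C" "r \<notin> C" using cut.hyps by (auto simp: C_def)
  then obtain a b where ab: "a \<notin> C" "b \<in> C" "(a, b) \<in> T"
    using first_entry[OF assms(4)[OF cut.hyps(2)]] by metis
  \<comment> \<open>No arc of the closure of \<open>S\<close> enters \<open>C\<close>. So the arc by
    which \<open>T\<close> enters \<open>C\<close> is new in this step and has not been counted
    before.\<close>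
  have "(a, b) \<notin> S\<^sup>*" using ab rtrancl_trans[of a b S v] by (auto simp: C_def)
  then have notS: "(a, b) \<notin> S" by auto
  have "(a, b) \<in> S'" using ab assms(3) by (auto simp: S'_def C_def)
  have "S \<subseteq> S'" by (auto simp: S'_def)
  then have "insert (a, b) (T \<inter> S - S0) \<subseteq> T \<inter> S' - S0"
    using ab \<open>(a, b) \<in> S'\<close> notS cut.IH by blast
  then have "Suc (card (T \<inter> S - S0)) \<le> card (T \<inter> S' - S0)"
    using notS assms(2) card_mono[of "T \<inter> S' - S0" "insert (a, b) (T \<inter> S - S0)"] by simp
  then show ?case using cut.IH \<open>S \<subseteq> S'\<close> unfolding S'_def by (meson Suc_le_mono le_trans subset_trans)
qed

text \<open>The parent of a vertex is a predecessor on a shortest path from the root.\<close>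

lemma ex_spanning_out_branching:
  assumes "finite V" "E \<subseteq> V \<times> V" "r \<in> V" "\<And>w. w \<in> V \<Longrightarrow> (r, w) \<in> E\<^sup>*"
  obtains T :: "('a, 'a \<times> 'a) pre_digraph"
  where "verts T = V" "arcs T \<subseteq> E" "tail T = fst" "head T = snd" "out_branching T"
proof -
  define dist where "dist w = (LEAST d. (r, w) \<in> E ^^ d)" for w
  have dist: "(r, w) \<in> E ^^ dist w" if "w \<in> V" for w
    using assms(4)[OF that] unfolding dist_def by (metis LeastI rtrancl_power)
  have "\<exists>u. (u, w) \<in> E \<and> dist u < dist w" if "w \<in> V - {r}" for w
  proof -
    have "dist w \<noteq> 0" using dist[of w] that by (intro notI) simp
    then obtain d where d: "dist w = Suc d" by (cases "dist w") auto
    have "(r, w) \<in> E ^^ d O E" using dist[of w] that d by simp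
    then obtain u where u: "(r, u) \<in> E ^^ d" "(u, w) \<in> E" by (rule relcompE) blast
    have "dist u \<le> d" unfolding dist_def by (rule Least_le) (rule u(1))
    then show ?thesis using u d by auto
  qed
  then obtain par where par: "\<And>w. w \<in> V - {r} \<Longrightarrow> (par w, w) \<in> E \<and> dist (par w) < dist w"
    by metis
  \<comment> \<open>Arcs are pairs with the projections as ends, which makes \<open>T\<close>
    compatible with \<open>with_proj G\<close> later on.\<close>
  define T where "T = \<lparr>verts = V, arcs = (\<lambda>w. (par w, w)) ` (V - {r}), tail = fst, head = snd\<rparr>"
  have ends: "arcs_ends T = arcs T" by (auto simp: arcs_ends_conv T_def)
  have verts_T: "verts T = V" by (simp add: T_def)
  have par_V: "par w \<in> V" if "w \<in> V" "w \<noteq> r" for w using par[of w] that assms(2) by blast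
  interpret T: wf_digraph T by unfold_locales (auto simp: T_def intro: par_V)
  have reach: "(r, w) \<in> (arcs T)\<^sup>*" if "w \<in> V" for w
    using that
  proof (induction "dist w" arbitrary: w rule: less_induct)
    case less
    show ?case
    proof (cases "w = r")
      case False
      have "(r, par w) \<in> (arcs T)\<^sup>*"
        using par[of w] False less assms(2) by blast
      moreover have "(par w, w) \<in> arcs T" using False less.prems by (auto simp: T_def)
      ultimately show ?thesis by simp
    qed simp
  qed
  have "connected T"
    unfolding connected_def
  proof (rule strongly_connectedI)
    show "verts (with_proj (mk_symmetric T)) \<noteq> {}" using assms(3) by (auto simp: T_def)
    interpret S: pair_wf_digraph "mk_symmetric T" by (rule T.wellformed_mk_symmetric)
    \<comment> \<open>\<open>connected\<close> means strong connectivity of the symmetric closure,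
      so any two vertices are joined by going through \<open>r\<close>.\<close>
    have 1: "r \<rightarrow>\<^sup>*\<^bsub>mk_symmetric T\<^esub> w" if "w \<in> V" for w
    proof (rule T.reachable_mk_symmetricI)
      have "r \<in> verts T" using assms(3) by (simp add: T_def)
      then show "r \<rightarrow>\<^sup>*\<^bsub>T\<^esub> w" using reach[OF that] by (simp only: T.reachable_conv' ends)
    qed
    then show "u \<rightarrow>\<^sup>*\<^bsub>mk_symmetric T\<^esub> w"
      if "u \<in> verts (with_proj (mk_symmetric T))" "w \<in> verts (with_proj (mk_symmetric T))" for u w
      using S.reachable_trans[OF symmetric_reachable[OF symmetric_mk_symmetric 1] 1] that
      by (simp add: verts_T)
  qed
  moreover have "in_degree T r = 0"
  proof -
    have "in_arcs T r = {}" by (auto simp: in_arcs_def T_def)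
    then show ?thesis by (simp add: in_degree_def)
  qed
  moreover have "in_degree T w = 1" if "w \<in> V - {r}" for w
  proof -
    have "in_arcs T w = {(par w, w)}" using that by (auto simp: in_arcs_def T_def)
    then show ?thesis by (simp add: in_degree_def)
  qed
  ultimately have "out_branching T"
    using assms(3) by (auto simp: out_branching_def T_def)
  then show ?thesis using par by (intro that[of T]) (auto simp: T_def)
qed

text \<open>The definition gives only weak connectivity and in-degrees. On an undirected walk from
  the root to an unreachable vertex, the first step into the unreachable set \<open>C\<close> must
  traverse an arc backwards, so some arc leads from \<open>C\<close> to a reachable vertex
  \<open>a\<close>. This contradicts in-degree 0 if \<open>a\<close> is the root, and in-degree 1
  otherwise.\<close>

lemma out_branching_reachable:
  assumes "fin_digraph T" "out_branching T"
  obtains r where "r \<in> verts T" "\<And>w. w \<in> verts T \<Longrightarrow> (r, w) \<in> (arcs_ends T)\<^sup>*"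
proof -
  interpret fin_digraph T by fact
  obtain r where r: "r \<in> verts T" "in_degree T r = 0" "\<And>v. v \<in> verts T - {r} \<Longrightarrow> in_degree T v = 1"
    and conn: "connected T"
    using assms(2) by (auto simp: out_branching_def)
  define C where "C = {w \<in> verts T. (r, w) \<notin> (arcs_ends T)\<^sup>*}"
  have "(r, w) \<in> (arcs_ends T)\<^sup>*" if w: "w \<in> verts T" for w
  proof (rule ccontr)
    assume "(r, w) \<notin> (arcs_ends T)\<^sup>*"
    then have "w \<in> C" "r \<notin> C" using w by (auto simp: C_def)
    have "(r, w) \<in> ((arcs_ends T)\<^sup>s)\<^sup>*"
      using conn r(1) w by (intro rtrancl_on_rtranclI[of _ _ "verts T"]) (simp add: connected_conv)
    then obtain a b where ab: "a \<notin> C" "b \<in> C" "(a, b) \<in> (arcs_ends T)\<^sup>s"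
      using first_entry[OF _ \<open>r \<notin> C\<close> \<open>w \<in> C\<close>] by metis
    have "a \<in> verts T" using ab(3) adj_in_verts by (auto simp: symcl_def)
    then have ra: "(r, a) \<in> (arcs_ends T)\<^sup>*" using ab(1) by (simp add: C_def)
    have "(a, b) \<notin> arcs_ends T"
    proof
      assume "(a, b) \<in> arcs_ends T"
      with ra have "(r, b) \<in> (arcs_ends T)\<^sup>*" by (rule rtrancl_into_rtrancl)
      then show False using ab(2) by (simp add: C_def)
    qed
    then have ba: "(b, a) \<in> arcs_ends T" using ab(3) by (auto simp: symcl_def)
    then obtain e where e: "e \<in> arcs T" "tail T e = b" "head T e = a" by auto
    show False
    proof (cases "a = r")
      case True
      have "in_arcs T r \<noteq> {}" using e True by force
      then have "in_degree T r \<noteq> 0" by (simp add: in_degree_def finite_in_arcs)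
      then show False using r(2) by simp
    next
      case False
      then obtain c where c: "(r, c) \<in> (arcs_ends T)\<^sup>*" "(c, a) \<in> arcs_ends T"
        using ra by (metis rtranclE)
      then obtain e' where e': "e' \<in> arcs T" "tail T e' = c" "head T e' = a" by auto
      \<comment> \<open>In-degree 1 forces the last arc of a path from \<open>r\<close> to
        \<open>a\<close> to be the arc from \<open>b\<close>, so \<open>b\<close> would be
        reachable.\<close>
      obtain x where "in_arcs T a = {x}"
        using r(3)[of a] False \<open>a \<in> verts T\<close> unfolding in_degree_def by (auto simp: card_1_singleton_iff)
      then have "e = e'" using e e' by (metis in_in_arcs_conv singletonD)
      then have "c = b" using e e' by simp
      then show False using c(1) ab(2) by (simp add: C_def)
    qed
  qed
  then show ?thesis using that r(1) by blast
qed

text \<open>Undoing all cuts leaves at most \<open>m\<close> selected arcs, hence a set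
  \<open>Y\<close> of at most \<open>m\<close> tails in \<open>X\<close>. An out-branching that uses
  no other vertex of \<open>X\<close> as a tail has all of \<open>X - Y\<close> as leaves.
  \<open>S0\<close> may contain loops because the matrix of the program is reflexive.\<close>

lemma k_leaf_instanceI:
  assumes "pair_digraph G" "r \<in> pverts G" "X \<subseteq> pverts G"
    "cut_sequence (pverts G) (parcs G) r S0 S m" "S0 \<subseteq> Id \<union> {(a, b) \<in> parcs G. a \<notin> X}"
    "\<forall>w \<in> pverts G. (r, w) \<in> S\<^sup>*" "k + m \<le> card X"
  shows "k_leaf_instance k (with_proj G)"
proof -
  interpret pair_digraph G by fact
  have fin: "finite X" using assms(3) pair_finite_verts by (rule finite_subset)
  obtain F where F: "finite F" "F \<subseteq> parcs G" "card F \<le> m" "\<forall>w \<in> pverts G. (r, w) \<in> (S0 \<union> F)\<^sup>*"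
    using cut_sequence_select[OF assms(4), where F = "{}"] assms(6) by auto
  define Y where "Y = fst ` F \<inter> X"
  have "card Y \<le> m"
    using F(1,3) card_image_le[OF F(1), of fst] card_mono[of "fst ` F" Y] by (simp add: Y_def)
  define E where "E = {(a, b) \<in> parcs G. a \<notin> X \<or> a \<in> Y}"
  \<comment> \<open>Selected arcs with tail outside \<open>X\<close> are free anyway; the loops of
    \<open>S0\<close> are absorbed by the reflexive closure.\<close>
  have "S0 \<union> F \<subseteq> E\<^sup>="
    using assms(5) F(2) by (force simp: E_def Y_def)
  then have reach: "(r, w) \<in> E\<^sup>*" if "w \<in> pverts G" for w
    using that F(4) rtrancl_mono[of "S0 \<union> F" "E\<^sup>="] by auto
  have "E \<subseteq> pverts G \<times> pverts G" using wellformed' by (auto simp: E_def)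
  then obtain T :: "('a, 'a \<times> 'a) pre_digraph" where T: "verts T = pverts G" "arcs T \<subseteq> E"
      "tail T = fst" "head T = snd" "out_branching T"
    using ex_spanning_out_branching[OF pair_finite_verts _ assms(2)] reach by blast
  have "wf_digraph T" using T wellformed' by unfold_locales (auto simp: E_def)
  then have "spanning T (with_proj G)"
    using T wf_digraph by (auto simp: spanning_def subgraph_def compatible_def E_def)
  moreover have "X - Y \<subseteq> leaves T"
  proof
    fix v assume v: "v \<in> X - Y"
    then have "out_arcs T v = {}" using T by (auto simp: out_arcs_def E_def)
    then show "v \<in> leaves T"
      using v assms(3) T(1) by (auto simp: leaves_def internal_verts_def out_degree_def)
  qed
  then have "card (X - Y) \<le> card (leaves T)"
    using T(1) pair_finite_verts by (intro card_mono) (auto simp: leaves_def)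
  then have "k \<le> card (leaves T)"
    using \<open>card Y \<le> m\<close> assms(7) fin card_Diff_subset[of Y X] by (auto simp: Y_def)
  ultimately show ?thesis
    using T(5) by (auto simp: k_leaf_instance_def k_leaf_out_branchings_def)
qed

definition branching_verts :: "('a, 'b) pre_digraph \<Rightarrow> 'a set" where
  "branching_verts T = {v \<in> internal_verts T. out_degree T v > 1}"

text \<open>In \<open>T\<close>, vertices of \<open>K\<close> have out-degree 0 and the other
  vertices of \<open>X\<close> at most 1, so at most \<open>card X - k\<close> arcs have their tail
  in \<open>X\<close>. Every cut consumes one such arc. The root is fixed before the cut sequence,
  so the bound holds whatever components the program chooses.\<close>

lemma k_leaf_instanceE:
  assumes "pair_digraph G" "T \<in> k_leaf_out_branchings k (with_proj G)"
    "K \<subseteq> leaves T" "card K = k" "K \<subseteq> X" "X \<subseteq> pverts G" "X \<inter> branching_verts T = {}"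
  obtains r where "r \<in> pverts G"
    "\<forall>S0 S m. cut_sequence (pverts G) (parcs G) r S0 S m \<longrightarrow>
      {(a, b) \<in> parcs G. a \<notin> X} \<subseteq> S0 \<longrightarrow> k + m \<le> card X"
proof -
  interpret pair_digraph G by fact
  have fin: "finite X" using assms(6) pair_finite_verts by (rule finite_subset)
  have T: "verts T = pverts G" "arcs T \<subseteq> parcs G" "tail T = fst" "head T = snd"
    "out_branching T" "wf_digraph T"
    using assms(2) by (auto simp: k_leaf_out_branchings_def spanning_def subgraph_def compatible_def)
  have finT: "finite (arcs T)" using T(2) pair_finite_arcs by (rule finite_subset)
  interpret T: fin_digraph T
    using T finT pair_finite_verts by (intro wf_digraph.fin_digraphI) auto
  have ends: "arcs_ends T = arcs T" using T by (simp add: arcs_ends_conv)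
  obtain r where r: "r \<in> pverts G" "\<And>w. w \<in> pverts G \<Longrightarrow> (r, w) \<in> (arcs T)\<^sup>*"
    using out_branching_reachable[OF T.fin_digraph T(5)] T(1) ends by metis
  have deg: "out_degree T x \<le> of_bool (x \<notin> K)" if "x \<in> X" for x
  proof (cases "x \<in> K")
    case True
    then show ?thesis using assms(3) by (auto simp: leaves_def internal_verts_def)
  next
    case False
    then show ?thesis using that assms(6,7) T(1)
      by (auto simp: branching_verts_def internal_verts_def not_less)
  qed
  have "k + m \<le> card X"
    if cs: "cut_sequence (pverts G) (parcs G) r S0 S m" "{(a, b) \<in> parcs G. a \<notin> X} \<subseteq> S0" for S0 S m
  proof -
    have "m \<le> card (arcs T \<inter> S - S0)"
      using cut_sequence_le_card[OF cs(1) finT T(2)] r(2) by blast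
    \<comment> \<open>All arcs with tail outside \<open>X\<close> are already in \<open>S0\<close>,
      so an arc of \<open>T\<close> gained by a cut has its tail in \<open>X\<close>.\<close>
    also have "\<dots> \<le> card (\<Union>x \<in> X. out_arcs T x)"
    proof (rule card_mono)
      show "arcs T \<inter> S - S0 \<subseteq> (\<Union>x \<in> X. out_arcs T x)"
        using cs(2) T(2,3) by (auto simp: out_arcs_def) blast
    qed (use fin in auto)
    also have "\<dots> \<le> (\<Sum>x \<in> X. out_degree T x)"
      unfolding out_degree_def by (rule card_UN_le[OF fin])
    also have "\<dots> \<le> (\<Sum>x \<in> X. of_bool (x \<notin> K))" by (intro sum_mono deg)
    also have "\<dots> = card (X - K)" using fin by (simp add: sum.If_cases of_bool_def Diff_eq Collect_neg_eq)
    also have "\<dots> = card X - k" using assms(4,5) fin by (simp add: card_Diff_subset finite_subset)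
    finally have "m \<le> card X - k" .
    moreover have "k \<le> card X" using assms(4,5) fin card_mono by blast
    ultimately show ?thesis by simp
  qed
  then show ?thesis using that r(1) by blast
qed


section \<open>Polynomial bounds\<close>

text \<open>Domination instead of equality makes the class closed under the operations in
  \<open>time_bound\<close>, so that a fixed program is handled by induction on its syntax.\<close>

definition poly_bounded :: "(nat \<Rightarrow> nat) \<Rightarrow> bool" where
  "poly_bounded f \<longleftrightarrow> (\<exists>Q :: nat poly. \<forall>x. f x \<le> poly Q x)"

lemma poly_bounded_const: "poly_bounded (\<lambda>_. c)"
  unfolding poly_bounded_def by (rule exI[of _ "[:c:]"]) simp

lemma poly_bounded_id: "poly_bounded (\<lambda>x. x)"
  unfolding poly_bounded_def by (rule exI[of _ "[:0, 1:]"]) simp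

lemma poly_bounded_add:
  assumes "poly_bounded f" "poly_bounded g"
  shows "poly_bounded (\<lambda>x. f x + g x)"
proof -
  obtain P Q :: "nat poly" where "\<forall>x. f x \<le> poly P x" "\<forall>x. g x \<le> poly Q x"
    using assms by (auto simp: poly_bounded_def)
  then show ?thesis
    unfolding poly_bounded_def by (intro exI[of _ "P + Q"]) (auto intro: add_mono)
qed

lemma poly_bounded_mult:
  assumes "poly_bounded f" "poly_bounded g"
  shows "poly_bounded (\<lambda>x. f x * g x)"
proof -
  obtain P Q :: "nat poly" where "\<forall>x. f x \<le> poly P x" "\<forall>x. g x \<le> poly Q x"
    using assms by (auto simp: poly_bounded_def)
  then show ?thesis
    unfolding poly_bounded_def by (intro exI[of _ "P * Q"]) (auto intro: mult_mono)
qed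

lemma poly_bounded_Suc: "poly_bounded f \<Longrightarrow> poly_bounded (\<lambda>x. Suc (f x))"
  using poly_bounded_add[OF poly_bounded_const[of 1]] by simp

lemma poly_bounded_power: "poly_bounded f \<Longrightarrow> poly_bounded (\<lambda>x. f x ^ d)"
  by (induction d) (auto intro: poly_bounded_const poly_bounded_mult)

lemmas poly_bounded_intros = poly_bounded_const poly_bounded_id poly_bounded_add
  poly_bounded_mult poly_bounded_Suc poly_bounded_power

text \<open>Polynomials with natural coefficients are monotone, so a linear bound on the argument
  can be substituted. This passes from the word length to the input size.\<close>

lemma poly_bounded_compose_linear:
  assumes "poly_bounded f"
  obtains Q :: "nat poly" where "\<forall>x y. x \<le> a * y + b \<longrightarrow> f x \<le> poly Q y"
proof -
  obtain P :: "nat poly" where P: "\<And>x. f x \<le> poly P x"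
    using assms by (auto simp: poly_bounded_def)
  have mono: "poly P x \<le> poly P y" if "x \<le> y" for x y :: nat
    using that by (auto simp: poly_altdef intro!: sum_mono power_mono)
  have "f x \<le> poly (P \<circ>\<^sub>p [:b, a:]) y" if "x \<le> a * y + b" for x y
    using P[of x] mono[of x "b + y * a"] that by (simp add: poly_pcompose algebra_simps)
  then show ?thesis using that by blast
qed


section \<open>Verification of programs with a syntactic time bound\<close>

lemma less_two_power_blen: "m < 2 ^ blen m"
proof (cases "m = 0")
  case False
  then show ?thesis using floor_log_exp2_gt[of m] by (simp add: blen_def)
qed (simp add: blen_def)

text \<open>The successor is needed at \<open>b = 0\<close>: there \<open>m = 0\<close>, which has
  length 1.\<close>

lemma blen_le: "m < 2 ^ b \<Longrightarrow> blen m \<le> Suc b"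
  unfolding blen_def using floor_log_mono[THEN monoD, of m "2 ^ b"] by simp

definition bounded_state :: "nat \<Rightarrow> state \<Rightarrow> bool" where
  "bounded_state L \<sigma> \<longleftrightarrow> (\<forall>a i. \<sigma> a i < 2 ^ L)"

fun val_bits :: "expr \<Rightarrow> nat \<Rightarrow> nat" where
  "val_bits (Const m) L = blen m"
| "val_bits (Load a e) L = L"
| "val_bits (Op f d e) L = Suc (val_bits d L + val_bits e L)"

lemma xor_less_two_power:
  fixes a b :: nat
  assumes "a < 2 ^ m" "b < 2 ^ m"
  shows "Bit_Operations.xor a b < 2 ^ m"
  using assms by (metis take_bit_nat_eq_self_iff take_bit_xor)

text \<open>One bound serves all operations. Products need \<open>l + m\<close> bits; the extra bit
  covers the test \<open>0 = 0\<close>, whose value 1 does not fit into the 0 bits of its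
  operands.\<close>

lemma apply_op_less:
  assumes "a < 2 ^ l" "b < 2 ^ m"
  shows "apply_op f a b < 2 ^ Suc (l + m)"
proof -
  have l: "(2 :: nat) ^ l \<le> 2 ^ (l + m)" and m: "(2 :: nat) ^ m \<le> 2 ^ (l + m)" by simp_all
  show ?thesis
  proof (cases f)
    case Add
    show ?thesis unfolding Add apply_op.simps power_Suc using assms l m by linarith
  next
    case Mul
    have "a * b < 2 ^ l * 2 ^ m" using assms by (intro mult_strict_mono) auto
    then show ?thesis using Mul by (simp add: power_add)
  next
    case Div
    show ?thesis unfolding Div apply_op.simps power_Suc using assms l div_le_dividend[of a b] by linarith
  next
    case Mod
    show ?thesis unfolding Mod apply_op.simps power_Suc using assms l mod_less_eq_dividend[of a b] by linarith
  next
    case Xor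
    have "Bit_Operations.xor a b < 2 ^ (l + m)"
      using assms l m by (intro xor_less_two_power) linarith+
    then show ?thesis using Xor by simp
  next
    case Sub
    show ?thesis unfolding Sub apply_op.simps power_Suc using assms l by linarith
  next
    case Less
    then show ?thesis using one_less_power[of "2 :: nat" "Suc (l + m)"] by (simp del: power_Suc)
  next
    case Equal
    then show ?thesis using one_less_power[of "2 :: nat" "Suc (l + m)"] by (simp del: power_Suc)
  qed
qed

lemma val_less: "bounded_state L \<sigma> \<Longrightarrow> val e \<sigma> < 2 ^ val_bits e L"
proof (induction e)
  case (Const m)
  then show ?case by (simp add: less_two_power_blen)
next
  case (Load a e)
  then show ?case by (simp add: bounded_state_def)
next
  case (Op f d e)
  then show ?case using apply_op_less by simp
qed

fun cost_bound :: "expr \<Rightarrow> nat \<Rightarrow> nat" where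
  "cost_bound (Const m) L = blen m"
| "cost_bound (Load a e) L = cost_bound e L + Suc (val_bits e L) + Suc L"
| "cost_bound (Op f d e) L =
     cost_bound d L + cost_bound e L + Suc (val_bits d L) * Suc (val_bits e L)"

lemma cost_le: "bounded_state L \<sigma> \<Longrightarrow> cost e \<sigma> \<le> cost_bound e L"
proof (induction e)
  case (Load a e)
  have "blen (\<sigma> a (val e \<sigma>)) \<le> Suc L"
    using Load.prems by (intro blen_le) (simp add: bounded_state_def)
  then show ?case using Load blen_le[OF val_less, of L \<sigma> e] by simp
next
  case (Op f d e)
  have "blen (val d \<sigma>) * blen (val e \<sigma>) \<le> Suc (val_bits d L) * Suc (val_bits e L)"
    using Op.prems by (intro mult_mono blen_le val_less) auto
  then show ?case using Op by fastforce
qed simp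

text \<open>Valid for programs in which every loop runs at most \<open>(L + 1) ^ 5\<close> times.\<close>

fun time_bound :: "com \<Rightarrow> nat \<Rightarrow> nat" where
  "time_bound Skip L = 1"
| "time_bound (Store a d e) L =
     cost_bound d L + cost_bound e L + Suc (val_bits d L) + Suc (val_bits e L)"
| "time_bound (Flip a d) L = cost_bound d L + Suc (val_bits d L) + 1"
| "time_bound (Seq c d) L = time_bound c L + time_bound d L"
| "time_bound (If e c d) L = cost_bound e L + 1 + time_bound c L + time_bound d L"
| "time_bound (While e c) L =
     (L + 1) ^ 5 * (cost_bound e L + 1 + time_bound c L) + cost_bound e L + 1"

lemma poly_bounded_val_bits: "poly_bounded (\<lambda>L. val_bits e L)"
  by (induction e) (auto intro!: poly_bounded_intros)

lemma poly_bounded_cost_bound: "poly_bounded (\<lambda>L. cost_bound e L)"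
  by (induction e) (auto intro!: poly_bounded_intros poly_bounded_val_bits)

lemma poly_bounded_time_bound: "poly_bounded (\<lambda>L. time_bound c L)"
  by (induction c)
    (auto intro!: poly_bounded_intros poly_bounded_val_bits poly_bounded_cost_bound)

text \<open>The sequencing rules want the continuation as a function of the intermediate state
  alone, not of the state paired with the elapsed time; hence the choice is made on the image under
  \<open>fst\<close>.\<close>

lemma exec_choice:
  assumes "\<forall>x \<in> set_pmf p. \<exists>q. exec c (fst x) q \<and> P (fst x) q"
  obtains q where "\<forall>x \<in> set_pmf p. exec c (fst x) (q (fst x)) \<and> P (fst x) (q (fst x))"
proof -
  have "\<forall>\<sigma> \<in> fst ` set_pmf p. \<exists>q. exec c \<sigma> q \<and> P \<sigma> q" using assms by blast
  then obtain q where "\<forall>\<sigma> \<in> fst ` set_pmf p. exec c \<sigma> (q \<sigma>) \<and> P \<sigma> (q \<sigma>)" by metis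
  then show ?thesis using that[of q] by blast
qed

lemma set_pmf_delay: "set_pmf (delay t p) = (\<lambda>(\<sigma>, u). (\<sigma>, t + u)) ` set_pmf p"
  by (simp add: delay_def)

fun writes :: "com \<Rightarrow> string set" where
  "writes Skip = {}"
| "writes (Store a d e) = {a}"
| "writes (Flip a d) = {a}"
| "writes (Seq c d) = writes c \<union> writes d"
| "writes (If e c d) = writes c \<union> writes d"
| "writes (While e c) = writes c"

lemma exec_unwritten:
  "exec c \<sigma> p \<Longrightarrow> x \<in> set_pmf p \<Longrightarrow> a \<notin> writes c \<Longrightarrow> fst x a = \<sigma> a"
proof (induction arbitrary: x rule: exec.induct)
  case (Seq c \<sigma> p c' q)
  then show ?case by (fastforce simp: set_pmf_delay split: prod.splits)
next
  case (While_true e \<sigma> c p q)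
  then show ?case by (fastforce simp: set_pmf_delay split: prod.splits)
qed (auto simp: update_def set_pmf_delay split: prod.splits)

text \<open>
  A total correctness assertion that also carries the time bound. Only states whose cells have at
  most \<open>L\<close> bits are considered, and the program must preserve this bound.
\<close>

definition wp :: "nat \<Rightarrow> com \<Rightarrow> (state \<Rightarrow> bool) \<Rightarrow> state \<Rightarrow> bool" where
  "wp L c Q \<sigma> \<longleftrightarrow> (bounded_state L \<sigma> \<longrightarrow>
     (\<exists>p. exec c \<sigma> p \<and>
       (\<forall>x \<in> set_pmf p. bounded_state L (fst x) \<and> Q (fst x) \<and> snd x \<le> time_bound c L)))"

lemma wpE:
  assumes "wp L c Q \<sigma>" "bounded_state L \<sigma>"
  obtains p where "exec c \<sigma> p"
    "\<And>x. x \<in> set_pmf p \<Longrightarrow> bounded_state L (fst x) \<and> Q (fst x) \<and> snd x \<le> time_bound c L"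
  using assms unfolding wp_def by blast

text \<open>Weakening with a built-in frame rule: specifications need to mention only the arrays
  that a program writes.\<close>

lemma wp_conseq:
  assumes "wp L c Q \<sigma>"
    "\<And>\<tau>. bounded_state L \<tau> \<Longrightarrow> (\<And>a. a \<notin> writes c \<Longrightarrow> \<tau> a = \<sigma> a) \<Longrightarrow> Q \<tau> \<Longrightarrow> Q' \<tau>"
  shows "wp L c Q' \<sigma>"
  unfolding wp_def
proof
  assume b: "bounded_state L \<sigma>"
  obtain p where p: "exec c \<sigma> p"
    "\<And>x. x \<in> set_pmf p \<Longrightarrow> bounded_state L (fst x) \<and> Q (fst x) \<and> snd x \<le> time_bound c L"
    using wpE[OF assms(1) b] by blast
  then show "\<exists>p. exec c \<sigma> p \<and>
       (\<forall>x \<in> set_pmf p. bounded_state L (fst x) \<and> Q' (fst x) \<and> snd x \<le> time_bound c L)"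
    using assms(2) exec_unwritten[OF p(1)] by (intro exI[of _ p]) blast
qed

lemma bounded_state_update: "bounded_state L \<sigma> \<Longrightarrow> x < 2 ^ L \<Longrightarrow> bounded_state L (update \<sigma> a i x)"
  by (simp add: bounded_state_def update_def)

section \<open>Rules for the individual commands\<close>

lemma wp_Skip: "Q \<sigma> \<Longrightarrow> wp L Skip Q \<sigma>"
  unfolding wp_def by (intro impI exI conjI, rule exec.Skip) simp

lemma wp_Store:
  assumes "bounded_state L \<sigma> \<Longrightarrow> val e \<sigma> < 2 ^ L" "Q (update \<sigma> a (val d \<sigma>) (val e \<sigma>))"
  shows "wp L (Store a d e) Q \<sigma>"
  unfolding wp_def
proof (intro impI exI conjI)
  assume b: "bounded_state L \<sigma>"
  have "cost d \<sigma> + cost e \<sigma> + blen (val d \<sigma>) + blen (val e \<sigma>)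
    \<le> cost_bound d L + cost_bound e L + Suc (val_bits d L) + Suc (val_bits e L)"
    using b by (intro add_mono cost_le blen_le val_less)
  then show "\<forall>x \<in> set_pmf (return_pmf (update \<sigma> a (val d \<sigma>) (val e \<sigma>),
      cost d \<sigma> + cost e \<sigma> + blen (val d \<sigma>) + blen (val e \<sigma>))).
      bounded_state L (fst x) \<and> Q (fst x) \<and> snd x \<le> time_bound (Store a d e) L"
    using assms b by (simp add: bounded_state_update)
qed (rule exec.Store)

lemma wp_Flip:
  assumes "0 < L" "\<And>b. Q (update \<sigma> a (val d \<sigma>) (of_bool b))"
  shows "wp L (Flip a d) Q \<sigma>"
  unfolding wp_def
proof (intro impI exI conjI)
  assume b: "bounded_state L \<sigma>"
  have "(1 :: nat) < 2 ^ L" using assms(1) by (simp only: one_less_power)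
  then have "of_bool b < (2 :: nat) ^ L" for b by (cases b) simp_all
  moreover have "cost d \<sigma> + blen (val d \<sigma>) + 1 \<le> cost_bound d L + Suc (val_bits d L) + 1"
    using b by (intro add_mono cost_le blen_le val_less order_refl)
  ultimately show "\<forall>x \<in> set_pmf (map_pmf (\<lambda>b. (update \<sigma> a (val d \<sigma>) (of_bool b), cost d \<sigma> + blen (val d \<sigma>) + 1))
       (bernoulli_pmf (1/2))).
      bounded_state L (fst x) \<and> Q (fst x) \<and> snd x \<le> time_bound (Flip a d) L"
    using assms b by (auto simp: bounded_state_update)
qed (rule exec.Flip)

lemma wp_Seq:
  assumes "wp L c (wp L d Q) \<sigma>"
  shows "wp L (Seq c d) Q \<sigma>"
  unfolding wp_def
proof
  assume b: "bounded_state L \<sigma>"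
  obtain p where p: "exec c \<sigma> p"
    "\<And>x. x \<in> set_pmf p \<Longrightarrow>
      bounded_state L (fst x) \<and> wp L d Q (fst x) \<and> snd x \<le> time_bound c L"
    using wpE[OF assms(1) b] by blast
  then have "\<forall>x \<in> set_pmf p. \<exists>q. exec d (fst x) q \<and>
      (\<forall>y \<in> set_pmf q. bounded_state L (fst y) \<and> Q (fst y) \<and> snd y \<le> time_bound d L)"
    unfolding wp_def by blast
  then obtain q where q: "\<forall>x \<in> set_pmf p. exec d (fst x) (q (fst x)) \<and>
      (\<forall>y \<in> set_pmf (q (fst x)). bounded_state L (fst y) \<and> Q (fst y) \<and> snd y \<le> time_bound d L)"
    by (rule exec_choice)
  show "\<exists>p. exec (Seq c d) \<sigma> p \<and>
    (\<forall>x \<in> set_pmf p. bounded_state L (fst x) \<and> Q (fst x) \<and> snd x \<le> time_bound (Seq c d) L)"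
  proof (intro exI conjI)
    show "exec (Seq c d) \<sigma> (bind_pmf p (\<lambda>(\<sigma>', t). delay t (q \<sigma>')))"
      using p(1) q by (intro exec.Seq) simp_all
    show "\<forall>x \<in> set_pmf (bind_pmf p (\<lambda>(\<sigma>', t). delay t (q \<sigma>'))).
      bounded_state L (fst x) \<and> Q (fst x) \<and> snd x \<le> time_bound (Seq c d) L"
      using p(2) q by (fastforce simp: set_pmf_delay intro: add_mono)
  qed
qed

lemma wp_If:
  assumes "val e \<sigma> \<noteq> 0 \<Longrightarrow> wp L c Q \<sigma>" "val e \<sigma> = 0 \<Longrightarrow> wp L d Q \<sigma>"
  shows "wp L (If e c d) Q \<sigma>"
  unfolding wp_def
proof
  assume b: "bounded_state L \<sigma>"
  show "\<exists>p. exec (If e c d) \<sigma> p \<and>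
    (\<forall>x \<in> set_pmf p. bounded_state L (fst x) \<and> Q (fst x) \<and> snd x \<le> time_bound (If e c d) L)"
  proof (cases "val e \<sigma> = 0")
    case True
    then obtain p where "exec d \<sigma> p" 
      "\<And>x. x \<in> set_pmf p \<Longrightarrow> bounded_state L (fst x) \<and> Q (fst x) \<and> snd x \<le> time_bound d L"
      using wpE[OF assms(2) b] by blast
    note p = this
    show ?thesis
    proof (intro exI conjI)
      show "exec (If e c d) \<sigma> (delay (cost e \<sigma> + 1) p)"
        using p(1) True by (intro exec.If_false)
    qed (use p(2) cost_le[OF b, of e] in \<open>fastforce simp: set_pmf_delay\<close>)
  next
    case False
    then obtain p where "exec c \<sigma> p" 
      "\<And>x. x \<in> set_pmf p \<Longrightarrow> bounded_state L (fst x) \<and> Q (fst x) \<and> snd x \<le> time_bound c L"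
      using wpE[OF assms(1) b] by blast
    note p = this
    show ?thesis
    proof (intro exI conjI)
      show "exec (If e c d) \<sigma> (delay (cost e \<sigma> + 1) p)"
        using p(1) False by (intro exec.If_true)
    qed (use p(2) cost_le[OF b, of e] in \<open>fastforce simp: set_pmf_delay\<close>)
  qed
qed

text \<open>The property \<open>P\<close> of the remaining run is arbitrary, so the same unfolding
  serves the loops with a fixed number of rounds and the probabilistic main loop.\<close>

lemma exec_While_true:
  assumes "val e \<sigma> \<noteq> 0" "exec c \<sigma> p" "\<forall>x \<in> set_pmf p. \<exists>q. exec (While e c) (fst x) q \<and> P (fst x) q"
  obtains q where "\<forall>x \<in> set_pmf p. exec (While e c) (fst x) (q (fst x)) \<and> P (fst x) (q (fst x))"
    "exec (While e c) \<sigma> (delay (cost e \<sigma> + 1) (bind_pmf p (\<lambda>(\<sigma>', t). delay t (q \<sigma>'))))"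
proof -
  obtain q where "\<forall>x \<in> set_pmf p. exec (While e c) (fst x) (q (fst x)) \<and> P (fst x) (q (fst x))"
    using assms(3) by (rule exec_choice)
  then show ?thesis using assms exec.While_true[OF assms(1,2), of q] by (intro that[of q]) blast+
qed

text \<open>The invariant is indexed by the round and forces exactly \<open>N\<close> rounds; the
  induction is on the number of rounds left. The exponent 5 comes from the longest such loop, the
  transitive closure, which runs \<open>n ^ 5\<close> times.\<close>

lemma wp_While:
  assumes "I 0 \<sigma>" "N \<le> (L + 1) ^ 5"
    "\<And>i \<tau>. i < N \<Longrightarrow> I i \<tau> \<Longrightarrow> val e \<tau> \<noteq> 0 \<and> wp L c (I (Suc i)) \<tau>"
    "\<And>\<tau>. I N \<tau> \<Longrightarrow> val e \<tau> = 0"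
  shows "wp L (While e c) (I N) \<sigma>"
proof -
  define T where "T = cost_bound e L + 1 + time_bound c L"
  have "\<exists>p. exec (While e c) \<tau> p \<and> (\<forall>x \<in> set_pmf p. bounded_state L (fst x) \<and> I N (fst x) \<and>
      snd x \<le> d * T + cost_bound e L + 1)"
    if "bounded_state L \<tau>" "I (N - d) \<tau>" "d \<le> N" for d \<tau>
    using that
  proof (induction d arbitrary: \<tau>)
    case 0
    then have "val e \<tau> = 0" using assms(4) by simp
    then have "exec (While e c) \<tau> (return_pmf (\<tau>, cost e \<tau> + 1))" by (rule exec.While_false)
    then show ?case using cost_le[OF 0(1), of e] 0 by fastforce
  next
    case (Suc d)
    have i: "N - Suc d < N" "Suc (N - Suc d) = N - d" using Suc.prems by auto
    note body = assms(3)[OF i(1) Suc.prems(2), unfolded i(2)]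
    obtain p where p: "exec c \<tau> p"
      "\<And>x. x \<in> set_pmf p \<Longrightarrow> bounded_state L (fst x) \<and> I (N - d) (fst x) \<and> snd x \<le> time_bound c L"
      using wpE[OF conjunct2[OF body] Suc.prems(1)] by blast
    have "\<forall>x \<in> set_pmf p. \<exists>q. exec (While e c) (fst x) q \<and> (\<forall>y \<in> set_pmf q. bounded_state L (fst y) \<and> I N (fst y) \<and>
      snd y \<le> d * T + cost_bound e L + 1)"
      using p(2) Suc.IH Suc.prems(3) by auto
    then obtain q where q: "\<forall>x \<in> set_pmf p. exec (While e c) (fst x) (q (fst x)) \<and>
        (\<forall>y \<in> set_pmf (q (fst x)). bounded_state L (fst y) \<and> I N (fst y) \<and> snd y \<le> d * T + cost_bound e L + 1)"
      "exec (While e c) \<tau> (delay (cost e \<tau> + 1) (bind_pmf p (\<lambda>(\<sigma>', t). delay t (q \<sigma>'))))"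
      by (rule exec_While_true[OF conjunct1[OF body] p(1), where P = "\<lambda>_ q. \<forall>y \<in> set_pmf q.
        bounded_state L (fst y) \<and> I N (fst y) \<and> snd y \<le> d * T + cost_bound e L + 1"])
    have "bounded_state L (fst y) \<and> I N (fst y) \<and>
        cost e \<tau> + 1 + (snd x + snd y) \<le> Suc d * T + cost_bound e L + 1"
      if "x \<in> set_pmf p" "y \<in> set_pmf (q (fst x))" for x y
      using q(1) p(2)[OF that(1)] that cost_le[OF Suc.prems(1), of e] by (fastforce simp: T_def)
    then have "\<forall>x \<in> set_pmf (delay (cost e \<tau> + 1) (bind_pmf p (\<lambda>(\<sigma>', t). delay t (q \<sigma>')))).
        bounded_state L (fst x) \<and> I N (fst x) \<and> snd x \<le> Suc d * T + cost_bound e L + 1"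
      by (auto simp: set_pmf_delay)
    then show ?case using q(2) by blast
  qed
  note main = this
  show ?thesis
    unfolding wp_def
  proof
    assume "bounded_state L \<sigma>"
    then obtain p where p: "exec (While e c) \<sigma> p"
      "\<forall>x \<in> set_pmf p. bounded_state L (fst x) \<and> I N (fst x) \<and> snd x \<le> N * T + cost_bound e L + 1"
      using main[of \<sigma> N] assms(1) by auto
    have "N * T + cost_bound e L + 1 \<le> time_bound (While e c) L"
      using mult_right_mono[OF assms(2) zero_le, of T]
      by (simp only: time_bound.simps T_def add.assoc)
    then have "\<forall>x \<in> set_pmf p. bounded_state L (fst x) \<and> I N (fst x) \<and> snd x \<le> time_bound (While e c) L"
      using p(2) order_trans by blast
    then show "\<exists>p. exec (While e c) \<sigma> p \<and>
      (\<forall>x \<in> set_pmf p. bounded_state L (fst x) \<and> I N (fst x) \<and> snd x \<le> time_bound (While e c) L)"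
      using p(1) by blast
  qed
qed

definition For :: "string \<Rightarrow> expr \<Rightarrow> com \<Rightarrow> com" where
  "For x e c = Seq (Store x (Const 0) (Const 0))
     (While (Op Less (Load x (Const 0)) e)
       (Seq c (Store x (Const 0) (Op Add (Load x (Const 0)) (Const 1)))))"

lemma writes_For [simp]: "writes (For x e c) = insert x (writes c)"
  by (auto simp: For_def)

text \<open>The limit \<open>e\<close> is evaluated anew in every round, so \<open>bound\<close>
  asks that it keep its value as long as only the counter and the arrays written by the body change.
  The invariant is required after the increment, which is why \<open>step\<close> speaks of
  \<open>update \<tau>' x 0 (Suc i)\<close>. The final counter value \<open>N\<close> must also fit
  into a cell.\<close>

lemma wp_For:
  assumes init: "I 0 (update \<sigma> x 0 0)"
    and step: "\<And>i \<tau>. i < N \<Longrightarrow> I i \<tau> \<Longrightarrow> \<tau> x 0 = i \<Longrightarrow>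
      (\<And>a. a \<noteq> x \<Longrightarrow> a \<notin> writes c \<Longrightarrow> \<tau> a = \<sigma> a) \<Longrightarrow>
      wp L c (\<lambda>\<tau>'. I (Suc i) (update \<tau>' x 0 (Suc i))) \<tau>"
    and bound: "\<And>\<tau>. (\<And>a. a \<noteq> x \<Longrightarrow> a \<notin> writes c \<Longrightarrow> \<tau> a = \<sigma> a) \<Longrightarrow> val e \<tau> = N"
    and N: "N \<le> (L + 1) ^ 5" "N < 2 ^ L"
    and x: "x \<notin> writes c"
    and post: "\<And>\<tau>. I N \<tau> \<Longrightarrow> (\<And>a. a \<noteq> x \<Longrightarrow> a \<notin> writes c \<Longrightarrow> \<tau> a = \<sigma> a) \<Longrightarrow>
      bounded_state L \<tau> \<Longrightarrow> Q \<tau>"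
  shows "wp L (For x e c) Q \<sigma>"
proof -
  define J where "J i \<tau> \<longleftrightarrow> I i \<tau> \<and> \<tau> x 0 = i \<and> (\<forall>a. a \<noteq> x \<longrightarrow> a \<notin> writes c \<longrightarrow> \<tau> a = \<sigma> a)"
    for i \<tau>
  have J0: "J 0 (update \<sigma> x 0 0)" using init by (simp add: J_def update_def)
  have "wp L (While (Op Less (Load x (Const 0)) e)
       (Seq c (Store x (Const 0) (Op Add (Load x (Const 0)) (Const 1))))) (J N) (update \<sigma> x 0 0)"
  proof (rule wp_While[of J, OF J0 N(1)])
    fix i \<tau> assume i: "i < N" "J i \<tau>"
    have "val (Op Less (Load x (Const 0)) e) \<tau> \<noteq> 0" using i bound[of \<tau>] by (simp add: J_def)
    moreover have "wp L c (\<lambda>\<tau>'. I (Suc i) (update \<tau>' x 0 (Suc i))) \<tau>"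
      using i by (intro step) (auto simp: J_def)
    then have "wp L (Seq c (Store x (Const 0) (Op Add (Load x (Const 0)) (Const 1)))) (J (Suc i)) \<tau>"
    proof (intro wp_Seq, elim wp_conseq)
      fix \<tau>' assume \<tau>': "\<And>a. a \<notin> writes c \<Longrightarrow> \<tau>' a = \<tau> a" "I (Suc i) (update \<tau>' x 0 (Suc i))"
      then show "wp L (Store x (Const 0) (Op Add (Load x (Const 0)) (Const 1))) (J (Suc i)) \<tau>'"
        using i x N(2) by (intro wp_Store) (auto simp: J_def update_def)
    qed
    ultimately show "val (Op Less (Load x (Const 0)) e) \<tau> \<noteq> 0 \<and>
      wp L (Seq c (Store x (Const 0) (Op Add (Load x (Const 0)) (Const 1)))) (J (Suc i)) \<tau>" by blast
  next
    fix \<tau> assume "J N \<tau>"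
    then show "val (Op Less (Load x (Const 0)) e) \<tau> = 0" using bound[of \<tau>] by (simp add: J_def)
  qed
  then show ?thesis
    unfolding For_def
  proof (intro wp_Seq wp_Store)
    assume "wp L (While (Op Less (Load x (Const 0)) e)
       (Seq c (Store x (Const 0) (Op Add (Load x (Const 0)) (Const 1))))) (J N) (update \<sigma> x 0 0)"
    then have "wp L (While (Op Less (Load x (Const 0)) e)
       (Seq c (Store x (Const 0) (Op Add (Load x (Const 0)) (Const 1))))) Q (update \<sigma> x 0 0)"
      by (rule wp_conseq) (auto simp: J_def intro: post)
    then show "wp L (While (Op Less (Load x (Const 0)) e)
       (Seq c (Store x (Const 0) (Op Add (Load x (Const 0)) (Const 1))))) Q
       (update \<sigma> x (val (Const 0) \<sigma>) (val (Const 0) \<sigma>))" by simp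
  qed simp
qed


section \<open>The program\<close>

abbreviation (input) scalar :: "string \<Rightarrow> expr" where
  "scalar x \<equiv> Load x (Const 0)"

abbreviation (input) assign :: "string \<Rightarrow> expr \<Rightarrow> com" (infix "::=" 61) where
  "x ::= e \<equiv> Store x (Const 0) e"

abbreviation (input) seq :: "com \<Rightarrow> com \<Rightarrow> com" (infixr ";;" 60) where
  "c ;; d \<equiv> Seq c d"

abbreviation (input) add_expr (infixl "[+]" 65) where "d [+] e \<equiv> Op Add d e"
abbreviation (input) sub_expr (infixl "[-]" 65) where "d [-] e \<equiv> Op Sub d e"
abbreviation (input) mult_expr (infixl "[*]" 70) where "d [*] e \<equiv> Op Mul d e"
abbreviation (input) div_expr (infixl "[div]" 70) where "d [div] e \<equiv> Op Div d e"
abbreviation (input) mod_expr (infixl "[mod]" 70) where "d [mod] e \<equiv> Op Mod d e"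
abbreviation (input) less_expr (infix "[<]" 50) where "d [<] e \<equiv> Op Less d e"
abbreviation (input) equal_expr (infix "[=]" 50) where "d [=] e \<equiv> Op Equal d e"

text \<open>Truncated subtraction sends every nonzero value to 0. Thus nonzero counts as true, and
  the disjunction, obtained by De Morgan's law, has value 0 or 1.\<close>

definition not_expr :: "expr \<Rightarrow> expr" where "not_expr e = Const 1 [-] e"
definition or_expr :: "expr \<Rightarrow> expr \<Rightarrow> expr" where
  "or_expr d e = not_expr (not_expr d [*] not_expr e)"

definition cell :: "string \<Rightarrow> expr \<Rightarrow> expr \<Rightarrow> expr" where
  "cell a d e = Load a (d [*] scalar ''n'' [+] e)"

lemma val_not_expr [simp]: "val (not_expr e) \<sigma> = of_bool (val e \<sigma> = 0)"
  by (cases "val e \<sigma>") (auto simp: not_expr_def)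

lemma val_or_expr [simp]: "val (or_expr d e) \<sigma> = of_bool (val d \<sigma> \<noteq> 0 \<or> val e \<sigma> \<noteq> 0)"
  by (auto simp: or_expr_def)

lemma val_cell [simp]: "val (cell a d e) \<sigma> = \<sigma> a (val d \<sigma> * \<sigma> ''n'' 0 + val e \<sigma>)"
  by (simp add: cell_def)

definition sample :: com where
  "sample = ''s'' ::= Const 0 ;; For ''i'' (scalar ''n'')
     (Flip ''X'' (scalar ''i'') ;; ''s'' ::= scalar ''s'' [+] Load ''X'' (scalar ''i''))"

text \<open>An entry of the initial matrix: the identity together with the free arcs, those whose
  tail is not in the sample.\<close>

definition init_value :: expr where
  "init_value = or_expr (scalar ''i'' [div] scalar ''n'' [=] scalar ''i'' [mod] scalar ''n'')
     (Load ''A'' (scalar ''i'') [*] not_expr (Load ''X'' (scalar ''i'' [div] scalar ''n'')))"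

definition init_relation :: com where
  "init_relation = For ''i'' (scalar ''n'' [*] scalar ''n'') (Store ''R'' (scalar ''i'') init_value)"

text \<open>A single flat loop replaces nested ones. The three lowest digits of the counter in base
  \<open>n\<close> are the start, the end and the last intermediate vertex of a path; the part above
  them is the number of the round.\<close>

definition digit0 :: expr where "digit0 = scalar ''i'' [mod] scalar ''n''"
definition digit1 :: expr where "digit1 = scalar ''i'' [div] scalar ''n'' [mod] scalar ''n''"
definition digit2 :: expr where
  "digit2 = scalar ''i'' [div] scalar ''n'' [div] scalar ''n'' [mod] scalar ''n''"

definition close_value :: expr where
  "close_value = or_expr (cell ''R'' digit0 digit1) (cell ''R'' digit0 digit2 [*] cell ''R'' digit2 digit1)"

definition close_relation :: com where
  "close_relation =
    For ''i'' (scalar ''n'' [*] scalar ''n'' [*] scalar ''n'' [*] scalar ''n'' [*] scalar ''n'')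
     (Store ''R'' (digit0 [*] scalar ''n'' [+] digit1) close_value)"

text \<open>
  The first loop looks for a vertex that is not reachable from the root. The second one moves from
  the current vertex to any vertex from which it is reachable; as reachability is transitive,
  one pass over the vertices ends in a component without entering arcs.
\<close>

definition find_source :: com where
  "find_source = ''v'' ::= scalar ''r'' ;;
     For ''i'' (scalar ''n'')
       (If (cell ''R'' (scalar ''r'') (scalar ''i'')) Skip (''v'' ::= scalar ''i'')) ;;
     For ''i'' (scalar ''n'')
       (If (cell ''R'' (scalar ''i'') (scalar ''v'')) (''v'' ::= scalar ''i'') Skip)"

text \<open>
  Column \<open>v\<close> of the relation describes the chosen component. It is saved in \<open>C\<close> because the second
  loop overwrites it.
\<close>

definition add_entering_arcs :: com where
  "add_entering_arcs =
     For ''i'' (scalar ''n'') (Store ''C'' (scalar ''i'') (cell ''R'' (scalar ''i'') (scalar ''v''))) ;;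
     For ''i'' (scalar ''n'' [*] scalar ''n'') (Store ''R'' (scalar ''i'')
       (or_expr (Load ''R'' (scalar ''i''))
         (Load ''A'' (scalar ''i'') [*] not_expr (Load ''C'' (scalar ''i'' [div] scalar ''n''))
           [*] Load ''C'' (scalar ''i'' [mod] scalar ''n''))))"

text \<open>
  The counter starts at \<open>k\<close>. If all \<open>n + 1\<close> rounds make a cut, then it exceeds \<open>n\<close>, hence also the
  size of the sample; otherwise the process has terminated.
\<close>

definition count_cuts :: com where
  "count_cuts = ''c'' ::= scalar ''k'' ;; init_relation ;;
     For ''t'' (scalar ''n'' [+] Const 1)
       (close_relation ;; find_source ;;
        ''c'' ::= scalar ''c'' [+] not_expr (cell ''R'' (scalar ''r'') (scalar ''v'')) ;;
        add_entering_arcs)"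

text \<open>Comparing with \<open>s + 1\<close> expresses that \<open>c\<close> is at most
  \<open>s\<close>, the size of the sample. The flag \<open>out\<close> is never lowered while the
  roots are tried.\<close>

definition trial :: com where
  "trial = sample ;; For ''r'' (scalar ''n'')
     (count_cuts ;; ''out'' ::= or_expr (scalar ''out'') (scalar ''c'' [<] scalar ''s'' [+] Const 1))"

definition guard :: expr where
  "guard = scalar ''cap'' [*] not_expr (scalar ''out'')"

definition attempt :: com where
  "attempt = ''cap'' ::= scalar ''cap'' [-] Const 1 ;; trial"

text \<open>The unknown \<open>s\<close> is replaced by its upper bound \<open>n\<close>; the power
  of two is produced by doubling.\<close>

definition set_cap :: com where
  "set_cap = ''cap'' ::= Const 1 ;;
     For ''j'' (scalar ''n'' [+] scalar ''k'') (''cap'' ::= scalar ''cap'' [+] scalar ''cap'') ;;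
     ''cap'' ::= scalar ''cap'' [*] scalar ''n''"

definition algorithm :: com where
  "algorithm = set_cap ;; While guard attempt"

definition relation :: "nat \<Rightarrow> state \<Rightarrow> (nat \<times> nat) set" where
  "relation n \<sigma> = {(a, b). a < n \<and> b < n \<and> \<sigma> ''R'' (a * n + b) \<noteq> 0}"

definition sampled :: "nat \<Rightarrow> state \<Rightarrow> nat set" where
  "sampled n \<sigma> = {a. a < n \<and> \<sigma> ''X'' a \<noteq> 0}"

text \<open>\<open>5 * n\<close> bits hold the counter of the closure loop, \<open>2 * n + k\<close>
  bits hold the cap, and the constant leaves room for the counter of cuts, which can reach
  \<open>k + n + 1\<close>.\<close>

definition word_size :: "nat \<Rightarrow> nat \<Rightarrow> nat" where
  "word_size n k = 5 * n + k + 3"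

section \<open>Matrix indices and size estimates\<close>

lemma pair_index:
  fixes a b n :: nat
  assumes "b < n"
  shows "(a * n + b) div n = a" "(a * n + b) mod n = b"
  using assms by simp_all

lemma pair_index_less:
  fixes a b n N :: nat
  assumes "a < N" "b < n"
  shows "a * n + b < N * n"
proof -
  have "a * n + b < Suc a * n" using assms by simp
  also have "\<dots> \<le> N * n" using assms by (intro mult_right_mono) auto
  finally show ?thesis .
qed

lemma pair_index_eq:
  fixes a b n :: nat
  assumes "b < n" "d < n"
  shows "a * n + b = c * n + d \<longleftrightarrow> a = c \<and> b = d"
  using pair_index[OF assms(1), of a] pair_index[OF assms(2), of c] by metis

lemma relation_update [simp]:
  "x \<noteq> ''R'' \<Longrightarrow> relation n (update \<sigma> x i y) = relation n \<sigma>"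
  by (simp add: relation_def update_def)

lemma relation_update_R:
  assumes "a < n" "b < n"
  shows "relation n (update \<sigma> ''R'' (a * n + b) (of_bool ((a, b) \<in> relation n \<sigma> \<or> P))) =
    relation n \<sigma> \<union> (if P then {(a, b)} else {})"
  using assms by (auto simp: relation_def update_def pair_index_eq)

lemma power5_less: "n ^ 5 < 2 ^ word_size n k" "n * n \<le> n ^ 5"
proof -
  have "n \<le> 2 ^ n" by (rule less_imp_le) (rule less_exp)
  then have "n ^ 5 \<le> (2 ^ n) ^ 5" by (intro power_mono) simp_all
  also have "\<dots> = 2 ^ (n * 5)" by (simp add: power_mult)
  also have "\<dots> < 2 ^ word_size n k" by (intro power_strict_increasing) (auto simp: word_size_def)
  finally show "n ^ 5 < 2 ^ word_size n k" .
  show "n * n \<le> n ^ 5"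
    using power_increasing[of 2 5 n] by (cases "n = 0") (auto simp: power2_eq_square)
qed

lemma power5_le: "n ^ 5 \<le> (word_size n k + 1) ^ 5"
  by (intro power_mono) (auto simp: word_size_def)

lemma linear_bounds: "n + k + 2 < 2 ^ word_size n k" "n + k + 2 \<le> (word_size n k + 1) ^ 5"
proof -
  have "word_size n k < 2 ^ word_size n k" by (rule less_exp)
  moreover have "n + k + 2 < word_size n k" by (simp add: word_size_def)
  ultimately show "n + k + 2 < 2 ^ word_size n k" by (rule less_trans[rotated])
  have "word_size n k + 1 \<le> (word_size n k + 1) ^ 5" by (rule self_le_power) auto
  then show "n + k + 2 \<le> (word_size n k + 1) ^ 5" by (simp add: word_size_def)
qed

lemma of_bool_less_two_power: "0 < L \<Longrightarrow> of_bool P < (2 :: nat) ^ L"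
  using one_less_power[of "2 :: nat" L] by (cases P) simp_all

lemma word_size_pos [simp]: "0 < word_size n k" by (simp add: word_size_def)

definition input_cell :: "nat \<Rightarrow> (nat \<times> nat) set \<Rightarrow> nat \<Rightarrow> nat" where
  "input_cell n E i = of_bool (i < n * n \<and> (i div n, i mod n) \<in> E)"

section \<open>Correctness of the parts of a trial\<close>

lemma wp_init_relation:
  assumes n: "\<sigma> ''n'' 0 = n" and A: "\<sigma> ''A'' = input_cell n E" and E: "E \<subseteq> {..<n} \<times> {..<n}"
  shows "wp (word_size n k) init_relation
    (\<lambda>\<tau>. relation n \<tau> = Id_on {..<n} \<union> {(a, b) \<in> E. a \<notin> sampled n \<sigma>}) \<sigma>"
proof -
  define P where "P j \<longleftrightarrow> j div n = j mod n \<or> (j div n, j mod n) \<in> E \<and> j div n \<notin> sampled n \<sigma>" for j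
  show ?thesis
    unfolding init_relation_def
  proof (rule wp_For[where N = "n * n" and I = "\<lambda>i \<tau>. \<forall>j < i. (\<tau> ''R'' j \<noteq> 0) = P j"])
    fix i and \<tau> :: state
    assume i: "i < n * n" "\<forall>j < i. (\<tau> ''R'' j \<noteq> 0) = P j" "\<tau> ''i'' 0 = i"
      and fr: "\<And>a. a \<noteq> ''i'' \<Longrightarrow> a \<notin> writes (Store ''R'' (scalar ''i'') init_value) \<Longrightarrow>
         \<tau> a = \<sigma> a"
    have eq: "\<tau> ''n'' 0 = n" "\<tau> ''A'' = input_cell n E" "\<tau> ''X'' = \<sigma> ''X''"
      using fr[of "''n''"] fr[of "''A''"] fr[of "''X''"] n A by simp_all
    have "i div n < n" using i(1) by (simp add: less_mult_imp_div_less)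
    then have "val init_value \<tau> = of_bool (P i)"
      using i by (simp add: init_value_def eq P_def input_cell_def sampled_def)
    then show "wp (word_size n k) (Store ''R'' (scalar ''i'') init_value)
       (\<lambda>\<tau>'. \<forall>j < Suc i. (update \<tau>' ''i'' 0 (Suc i) ''R'' j \<noteq> 0) = P j) \<tau>"
      using i(2,3) by (intro wp_Store) (auto simp: update_def less_Suc_eq of_bool_less_two_power)
  next
    fix \<tau> :: state
    assume R: "\<forall>j < n * n. (\<tau> ''R'' j \<noteq> 0) = P j"
    have "\<tau> ''R'' (a * n + b) \<noteq> 0 \<longleftrightarrow> a = b \<or> (a, b) \<in> E \<and> a \<notin> sampled n \<sigma>" if "a < n" "b < n" for a b
      using R pair_index_less[OF that] pair_index[OF that(2), of a] by (simp add: P_def)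
    then show "relation n \<tau> = Id_on {..<n} \<union> {(a, b) \<in> E. a \<notin> sampled n \<sigma>}"
      using E by (auto simp: relation_def)
  next
    show "n * n \<le> (word_size n k + 1) ^ 5" "n * n < 2 ^ word_size n k"
      using power5_le[of n k] power5_less(1)[of n k] power5_less(2)[of n] by linarith+
  qed (use n in simp_all)
qed

text \<open>
  Round \<open>d\<close> of the loop, which visits every triple of vertices once, completes the paths of
  length \<open>d + 1\<close>.
\<close>

lemma wp_close_relation:
  assumes n: "\<sigma> ''n'' 0 = n" and refl: "\<And>a. a < n \<Longrightarrow> (a, a) \<in> relation n \<sigma>"
  shows "wp (word_size n k) close_relation
    (\<lambda>\<tau>. relation n \<tau> = (relation n \<sigma>)\<^sup>* \<inter> {..<n} \<times> {..<n}) \<sigma>"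
proof -
  define S where "S = relation n \<sigma>"
  have S: "S \<subseteq> {..<n} \<times> {..<n}" by (auto simp: S_def relation_def)
  define A B C D where
    "A i = i mod n" and "B i = i div n mod n" and "C i = i div n div n mod n"
    and "D i = i div n div n div n" for i
  \<comment> \<open>Every index \<open>j\<close> already visited encodes a path of
    \<open>D j\<close> arcs from \<open>A j\<close> to \<open>C j\<close> followed by an arc to
    \<open>B j\<close>; if that path exists in \<open>S\<close>, its ends are related.\<close>
  define I where "I i \<tau> \<longleftrightarrow> S \<subseteq> relation n \<tau> \<and> relation n \<tau> \<subseteq> S\<^sup>* \<and>
    (\<forall>j < i. (A j, C j) \<in> S ^^ D j \<longrightarrow> (C j, B j) \<in> S \<longrightarrow> (A j, B j) \<in> relation n \<tau>)" for i \<tau>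
  define code where "code d c b a = ((d * n + c) * n + b) * n + a" for d c b a
  have decode: "A (code d c b a) = a" "B (code d c b a) = b" "C (code d c b a) = c" "D (code d c b a) = d"
    if "a < n" "b < n" "c < n" for a b c d
    using that by (simp_all add: code_def A_def B_def C_def D_def pair_index)
  have D_mono: "D i \<le> D j" if "i \<le> j" for i j
    using that by (simp add: D_def div_le_mono)
  show ?thesis
    unfolding close_relation_def Let_def
  proof (rule wp_For[where N = "n ^ 5" and I = I])
    show "I 0 (update \<sigma> ''i'' 0 0)" by (auto simp: I_def S_def)
  next
    fix i and \<tau> :: state
    assume i: "i < n ^ 5" "I i \<tau>" "\<tau> ''i'' 0 = i"
      and fr: "\<And>a. a \<noteq> ''i'' \<Longrightarrow> a \<notin> writes (Store ''R'' (digit0 [*] scalar ''n'' [+] digit1) close_value) \<Longrightarrow>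
         \<tau> a = \<sigma> a"
    have "\<tau> ''n'' 0 = n" using fr[of "''n''"] n by simp
    have "n > 0" using i(1) by (cases n) auto
    then have lt: "A i < n" "B i < n" "C i < n" by (simp_all add: A_def B_def C_def)
    define hop where "hop \<longleftrightarrow> (A i, C i) \<in> relation n \<tau> \<and> (C i, B i) \<in> relation n \<tau>"
    define \<tau>' where "\<tau>' = update \<tau> ''R'' (A i * n + B i) (of_bool ((A i, B i) \<in> relation n \<tau> \<or> hop))"
    have rel: "relation n \<tau>' = relation n \<tau> \<union> (if hop then {(A i, B i)} else {})"
      unfolding \<tau>'_def using lt by (intro relation_update_R)
    have "I (Suc i) \<tau>'"
      unfolding I_def
    proof (intro conjI allI impI)
      show "S \<subseteq> relation n \<tau>'" using i(2) rel by (auto simp: I_def)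
      have "(A i, B i) \<in> S\<^sup>*" if hop
        using that i(2) unfolding hop_def I_def by (meson rtrancl_trans subsetD)
      then show "relation n \<tau>' \<subseteq> S\<^sup>*" using i(2) rel by (auto simp: I_def split: if_splits)
    next
      fix j assume j: "j < Suc i" "(A j, C j) \<in> S ^^ D j" "(C j, B j) \<in> S"
      show "(A j, B j) \<in> relation n \<tau>'"
      proof (cases "j = i")
        case False
        then show ?thesis using j i(2) rel by (auto simp: I_def less_Suc_eq)
      next
        case True
        have "(A i, C i) \<in> relation n \<tau>"
        proof (cases "D i")
          case 0
          then have "A i = C i" using j(2) True by simp
          then show ?thesis using refl[OF lt(1)] i(2) by (auto simp: I_def S_def)
        next
          case (Suc d)
          have "(A i, C i) \<in> S ^^ d O S" using j(2) Suc True by simp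
          then obtain m where m: "(A i, m) \<in> S ^^ d" "(m, C i) \<in> S" by (rule relcompE) blast
          have "m < n" using m(2) S by auto
          note dec = decode[OF lt(1) lt(3) \<open>m < n\<close>, of d]
          \<comment> \<open>The path to \<open>C i\<close> was completed one round earlier, with
            \<open>m\<close> as its last intermediate vertex. Its index is smaller because its round
            number is and \<open>D\<close> is monotone.\<close>
          have "code d m (C i) (A i) < i"
            using D_mono[of i "code d m (C i) (A i)"] dec(4) Suc by (cases "code d m (C i) (A i) < i") auto
          then show ?thesis using i(2) m dec unfolding I_def by metis
        qed
        moreover have "(C i, B i) \<in> relation n \<tau>" using j(3) True i(2) by (auto simp: I_def)
        ultimately show ?thesis using rel True by (simp add: hop_def)
      qed
    qed
    then have "I (Suc i) (update \<tau>' ''i'' 0 (Suc i))" by (simp add: I_def)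
    moreover have "val close_value \<tau> = of_bool ((A i, B i) \<in> relation n \<tau> \<or> hop)"
      using lt i(3) \<open>\<tau> ''n'' 0 = n\<close>
      by (simp add: hop_def relation_def A_def B_def C_def close_value_def digit0_def digit1_def digit2_def)
    ultimately show "wp (word_size n k) (Store ''R'' (digit0 [*] scalar ''n'' [+] digit1) close_value)
       (\<lambda>\<tau>'. I (Suc i) (update \<tau>' ''i'' 0 (Suc i))) \<tau>"
      using i(3) \<open>\<tau> ''n'' 0 = n\<close>
      by (intro wp_Store)
        (simp_all add: \<tau>'_def A_def B_def of_bool_less_two_power digit0_def digit1_def del: of_bool_or_iff)
  next
    fix \<tau> :: state
    assume I: "I (n ^ 5) \<tau>"
    have "(a, b) \<in> relation n \<tau>" if ab: "(a, b) \<in> S\<^sup>*" "a < n" "b < n" for a b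
    proof (cases "a = b")
      case True
      then show ?thesis using refl[of a] ab I by (auto simp: I_def S_def)
    next
      case False
      have fin: "finite S" using S finite_subset by blast
      obtain d where d: "d \<le> card S" "(a, b) \<in> S ^^ d"
        using ab(1) unfolding rtrancl_finite_eq_relpow[OF fin] by blast
      obtain d' where d': "d = Suc d'" using d(2) False by (cases d) auto
      have "(a, b) \<in> S ^^ d' O S" using d d' by simp
      then obtain m where m: "(a, m) \<in> S ^^ d'" "(m, b) \<in> S" by (rule relcompE) blast
      have "m < n" using m(2) S by auto
      \<comment> \<open>A path never needs more arcs than \<open>S\<close> has pairs, and
        \<open>n ^ 5\<close> iterations make \<open>n * n\<close> rounds of \<open>n ^ 3\<close>
        each.\<close>
      have "card S \<le> n * n" using card_mono[OF _ S] by simp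
      then have "d' < n * n" using d(1) d' by simp
      then have "code d' m b a < n * n * n * n * n"
        unfolding code_def using ab(2,3) \<open>m < n\<close> by (intro pair_index_less)
      then have "code d' m b a < n ^ 5" by (simp add: eval_nat_numeral algebra_simps)
      then show ?thesis
        using I m decode[OF ab(2,3) \<open>m < n\<close>, of d'] unfolding I_def by metis
    qed
    then show "relation n \<tau> = (relation n \<sigma>)\<^sup>* \<inter> {..<n} \<times> {..<n}"
      using I by (auto simp: I_def S_def) (auto simp: relation_def)
  qed (use power5_le[of n k] power5_less(1)[of n k] n in \<open>simp_all add: eval_nat_numeral\<close>)
qed

text \<open>After the first loop \<open>v\<close> is unreachable from the root unless everything is
  reachable. The second loop only moves to vertices that reach the previous ones, so by transitivity
  the root still cannot reach \<open>v\<close> in the former case.\<close>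

lemma wp_find_source:
  assumes n: "\<sigma> ''n'' 0 = n" and r: "\<sigma> ''r'' 0 < n"
    and refl: "\<And>a. a < n \<Longrightarrow> (a, a) \<in> relation n \<sigma>" and trans: "trans (relation n \<sigma>)"
  shows "wp (word_size n k) find_source
    (\<lambda>\<tau>. \<tau> ''v'' 0 < n \<and>
      (\<forall>w < n. (w, \<tau> ''v'' 0) \<in> relation n \<sigma> \<longrightarrow> (\<tau> ''v'' 0, w) \<in> relation n \<sigma>) \<and>
      ((\<sigma> ''r'' 0, \<tau> ''v'' 0) \<in> relation n \<sigma> \<longrightarrow> (\<forall>w < n. (\<sigma> ''r'' 0, w) \<in> relation n \<sigma>))) \<sigma>"
proof -
  define S r where "S = relation n \<sigma>" and "r = \<sigma> ''r'' 0"
  have mem: "(a, b) \<in> S \<longleftrightarrow> \<sigma> ''R'' (a * n + b) \<noteq> 0" if "a < n" "b < n" for a b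
    using that by (simp add: S_def relation_def)
  have n_bounds: "n \<le> (word_size n k + 1) ^ 5" "n < 2 ^ word_size n k"
    using linear_bounds[of n k] by simp_all
  define I1 where "I1 i \<tau> \<longleftrightarrow> \<tau> ''v'' 0 < n \<and>
    ((r, \<tau> ''v'' 0) \<notin> S \<or> (\<forall>w < i. (r, w) \<in> S))" for i and \<tau> :: state
  define I2 where "I2 u i \<tau> \<longleftrightarrow> \<tau> ''v'' 0 < n \<and> (\<tau> ''v'' 0, u) \<in> S \<and>
    (\<forall>w < i. (w, \<tau> ''v'' 0) \<in> S \<longrightarrow> (\<tau> ''v'' 0, w) \<in> S)" for u i and \<tau> :: state
  have loop1: "wp (word_size n k) (For ''i'' (scalar ''n'')
       (If (cell ''R'' (scalar ''r'') (scalar ''i'')) Skip (''v'' ::= scalar ''i''))) (I1 n) \<tau>"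
    if fr: "\<And>a. a \<noteq> ''v'' \<Longrightarrow> \<tau> a = \<sigma> a" and v: "\<tau> ''v'' 0 = r" for \<tau>
  proof (rule wp_For[where N = n and I = I1])
    show "I1 0 (update \<tau> ''i'' 0 0)" using v r by (simp add: I1_def r_def update_def)
  next
    fix i and \<rho> :: state
    assume i: "i < n" "I1 i \<rho>" "\<rho> ''i'' 0 = i" and fr': "\<And>a. a \<noteq> ''i'' \<Longrightarrow>
      a \<notin> writes (If (cell ''R'' (scalar ''r'') (scalar ''i'')) Skip (''v'' ::= scalar ''i'')) \<Longrightarrow>
      \<rho> a = \<tau> a"
    have eq: "\<rho> ''n'' 0 = n" "\<rho> ''r'' 0 = r" "\<rho> ''R'' = \<sigma> ''R''"
      using fr'[of "''n''"] fr'[of "''r''"] fr'[of "''R''"] fr n by (simp_all add: r_def)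
    have test: "val (cell ''R'' (scalar ''r'') (scalar ''i'')) \<rho> \<noteq> 0 \<longleftrightarrow> (r, i) \<in> S"
      using mem[of r i] r i by (simp add: eq r_def[symmetric])
    show "wp (word_size n k) (If (cell ''R'' (scalar ''r'') (scalar ''i'')) Skip (''v'' ::= scalar ''i''))
       (\<lambda>\<tau>'. I1 (Suc i) (update \<tau>' ''i'' 0 (Suc i))) \<rho>"
      using test i n_bounds
      by (intro wp_If wp_Skip wp_Store) (auto simp: I1_def update_def less_Suc_eq)
  qed (use n_bounds fr n in simp_all)
  have loop2: "wp (word_size n k) (For ''i'' (scalar ''n'')
       (If (cell ''R'' (scalar ''i'') (scalar ''v'')) (''v'' ::= scalar ''i'') Skip)) (I2 u n) \<tau>"
    if fr: "\<And>a. a \<noteq> ''v'' \<Longrightarrow> a \<noteq> ''i'' \<Longrightarrow> \<tau> a = \<sigma> a" and v: "\<tau> ''v'' 0 = u" "u < n" for \<tau> u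
  proof (rule wp_For[where N = n and I = "I2 u"])
    show "I2 u 0 (update \<tau> ''i'' 0 0)" using v refl[of u] by (simp add: I2_def S_def update_def)
  next
    fix i and \<rho> :: state
    assume i: "i < n" "I2 u i \<rho>" "\<rho> ''i'' 0 = i" and fr': "\<And>a. a \<noteq> ''i'' \<Longrightarrow>
      a \<notin> writes (If (cell ''R'' (scalar ''i'') (scalar ''v'')) (''v'' ::= scalar ''i'') Skip) \<Longrightarrow>
      \<rho> a = \<tau> a"
    have eq: "\<rho> ''n'' 0 = n" "\<rho> ''R'' = \<sigma> ''R''"
      using fr'[of "''n''"] fr'[of "''R''"] fr n by simp_all
    have "\<rho> ''v'' 0 < n" using i by (simp add: I2_def)
    then have test: "val (cell ''R'' (scalar ''i'') (scalar ''v'')) \<rho> \<noteq> 0 \<longleftrightarrow> (i, \<rho> ''v'' 0) \<in> S"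
      using mem[of i "\<rho> ''v'' 0"] i by (simp add: eq)
    have step: "I2 u (Suc i) (update (update \<rho> ''v'' 0 i) ''i'' 0 (Suc i))" if "(i, \<rho> ''v'' 0) \<in> S"
    proof -
      \<comment> \<open>Moving \<open>v\<close> to \<open>i\<close> keeps the vertices already
        examined in order: one that reaches \<open>i\<close> also reaches the old \<open>v\<close>,
        hence is reached from the old \<open>v\<close>, and so from \<open>i\<close>.\<close>
      have "(i, w) \<in> S" if "w < i" "(w, i) \<in> S" for w
        using that i(2) \<open>(i, \<rho> ''v'' 0) \<in> S\<close> trans unfolding I2_def S_def by (meson transD)
      moreover have "(i, u) \<in> S"
        using that i(2) trans unfolding I2_def S_def by (meson transD)
      ultimately show ?thesis using i by (auto simp: I2_def update_def less_Suc_eq)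
    qed
    show "wp (word_size n k) (If (cell ''R'' (scalar ''i'') (scalar ''v'')) (''v'' ::= scalar ''i'') Skip)
       (\<lambda>\<tau>'. I2 u (Suc i) (update \<tau>' ''i'' 0 (Suc i))) \<rho>"
    proof (intro wp_If wp_Skip wp_Store)
      assume "val (cell ''R'' (scalar ''i'') (scalar ''v'')) \<rho> \<noteq> 0"
      then show "I2 u (Suc i) (update (update \<rho> ''v'' (val (Const 0) \<rho>) (val (scalar ''i'') \<rho>)) ''i'' 0 (Suc i))"
        using step test i(3) by simp
    next
      assume "val (cell ''R'' (scalar ''i'') (scalar ''v'')) \<rho> = 0"
      then show "I2 u (Suc i) (update \<rho> ''i'' 0 (Suc i))"
        using i test by (auto simp: I2_def update_def less_Suc_eq)
    qed (use i n_bounds in simp)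
  qed (use n_bounds fr n in simp_all)
  show ?thesis
    unfolding find_source_def S_def[symmetric] r_def[symmetric]
  proof (intro wp_Seq wp_Store)
    show "val (scalar ''r'') \<sigma> < 2 ^ word_size n k" using r n_bounds by simp
    let ?\<tau> = "update \<sigma> ''v'' (val (Const 0) \<sigma>) (val (scalar ''r'') \<sigma>)"
    show "wp (word_size n k) (For ''i'' (scalar ''n'')
          (If (cell ''R'' (scalar ''r'') (scalar ''i'')) Skip (''v'' ::= scalar ''i'')))
        (wp (word_size n k) (For ''i'' (scalar ''n'')
          (If (cell ''R'' (scalar ''i'') (scalar ''v'')) (''v'' ::= scalar ''i'') Skip))
          (\<lambda>\<tau>. \<tau> ''v'' 0 < n \<and>
            (\<forall>w < n. (w, \<tau> ''v'' 0) \<in> S \<longrightarrow> (\<tau> ''v'' 0, w) \<in> S) \<and>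
            ((r, \<tau> ''v'' 0) \<in> S \<longrightarrow> (\<forall>w < n. (r, w) \<in> S)))) ?\<tau>"
    proof (rule wp_conseq[OF loop1], goal_cases)
      case (3 \<tau>)
      have fr: "\<tau> a = \<sigma> a" if "a \<noteq> ''v''" "a \<noteq> ''i''" for a
        using 3(2)[of a] that by (simp add: update_def)
      have v: "\<tau> ''v'' 0 < n" using 3(3) by (simp add: I1_def)
      show ?case
      proof (rule wp_conseq[OF loop2[OF fr HOL.refl v]], goal_cases)
        case (3 \<rho>)
        have "\<forall>w < n. (r, w) \<in> S" if "(r, \<rho> ''v'' 0) \<in> S"
        proof -
          have "(\<rho> ''v'' 0, \<tau> ''v'' 0) \<in> S" using 3 by (simp add: I2_def)
          then have "(r, \<tau> ''v'' 0) \<in> S" using that trans unfolding S_def by (meson transD)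
          then show ?thesis using \<open>I1 n \<tau>\<close> by (simp add: I1_def)
        qed
        then show ?case using 3 by (simp add: I2_def)
      qed simp_all
    qed (simp_all add: update_def r_def)
  qed
qed

lemma wp_add_entering_arcs:
  assumes n: "\<sigma> ''n'' 0 = n" and v: "\<sigma> ''v'' 0 = v" "v < n"
    and A: "\<sigma> ''A'' = input_cell n E" and E: "E \<subseteq> {..<n} \<times> {..<n}"
  shows "wp (word_size n k) add_entering_arcs
    (\<lambda>\<tau>. relation n \<tau> = relation n \<sigma> \<union>
      {(a, b). (a, b) \<in> E \<and> (a, v) \<notin> relation n \<sigma> \<and> (b, v) \<in> relation n \<sigma>}) \<sigma>"
proof -
  define S where "S = relation n \<sigma>"
  define P where "P j \<longleftrightarrow> (j div n, j mod n) \<in> E \<and> (j div n, v) \<notin> S \<and> (j mod n, v) \<in> S" for j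
  have mem: "(a, b) \<in> S \<longleftrightarrow> \<sigma> ''R'' (a * n + b) \<noteq> 0" if "a < n" "b < n" for a b
    using that by (simp add: S_def relation_def)
  define I1 where "I1 i \<tau> \<longleftrightarrow> (\<forall>j < i. \<tau> ''C'' j = \<sigma> ''R'' (j * n + v))" for i and \<tau> :: state
  define I2 where "I2 i \<tau> \<longleftrightarrow> (\<forall>j < n * n. \<tau> ''R'' j \<noteq> 0 \<longleftrightarrow> \<sigma> ''R'' j \<noteq> 0 \<or> j < i \<and> P j)"
    for i and \<tau> :: state
  define entry where "entry = or_expr (Load ''R'' (scalar ''i''))
         (Load ''A'' (scalar ''i'') [*] not_expr (Load ''C'' (scalar ''i'' [div] scalar ''n''))
           [*] Load ''C'' (scalar ''i'' [mod] scalar ''n''))"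
  have loop1: "wp (word_size n k) (For ''i'' (scalar ''n'')
       (Store ''C'' (scalar ''i'') (cell ''R'' (scalar ''i'') (scalar ''v'')))) (I1 n) \<sigma>"
  proof (rule wp_For[where N = n and I = I1])
    fix i and \<tau> :: state
    assume i: "i < n" "I1 i \<tau>" "\<tau> ''i'' 0 = i" and fr: "\<And>a. a \<noteq> ''i'' \<Longrightarrow>
      a \<notin> writes (Store ''C'' (scalar ''i'') (cell ''R'' (scalar ''i'') (scalar ''v''))) \<Longrightarrow>
      \<tau> a = \<sigma> a"
    have eq: "\<tau> ''n'' 0 = n" "\<tau> ''v'' 0 = v" "\<tau> ''R'' = \<sigma> ''R''"
      using fr[of "''n''"] fr[of "''v''"] fr[of "''R''"] n v by simp_all
    show "wp (word_size n k) (Store ''C'' (scalar ''i'') (cell ''R'' (scalar ''i'') (scalar ''v'')))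
       (\<lambda>\<tau>'. I1 (Suc i) (update \<tau>' ''i'' 0 (Suc i))) \<tau>"
    proof (rule wp_Store)
      assume "bounded_state (word_size n k) \<tau>"
      then show "val (cell ''R'' (scalar ''i'') (scalar ''v'')) \<tau> < 2 ^ word_size n k"
        by (simp add: bounded_state_def)
    next
      show "I1 (Suc i) (update (update \<tau> ''C'' (val (scalar ''i'') \<tau>)
         (val (cell ''R'' (scalar ''i'') (scalar ''v'')) \<tau>)) ''i'' 0 (Suc i))"
        using i eq by (auto simp: I1_def update_def less_Suc_eq)
    qed
  qed (use linear_bounds[of n k] n in \<open>simp_all add: I1_def\<close>)
  have loop2: "wp (word_size n k) (For ''i'' (scalar ''n'' [*] scalar ''n'') (Store ''R'' (scalar ''i'') entry))
      (\<lambda>\<tau>. relation n \<tau> = S \<union> {(a, b). (a, b) \<in> E \<and> (a, v) \<notin> S \<and> (b, v) \<in> S}) \<tau>"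
    if fr: "\<And>a. a \<noteq> ''C'' \<Longrightarrow> a \<noteq> ''i'' \<Longrightarrow> \<tau> a = \<sigma> a" and C: "I1 n \<tau>" for \<tau>
  proof (rule wp_For[where N = "n * n" and I = I2])
    show "I2 0 (update \<tau> ''i'' 0 0)" using fr[of "''R''"] by (simp add: I2_def update_def)
  next
    fix i and \<rho> :: state
    assume i: "i < n * n" "I2 i \<rho>" "\<rho> ''i'' 0 = i" and fr': "\<And>a. a \<noteq> ''i'' \<Longrightarrow>
      a \<notin> writes (Store ''R'' (scalar ''i'') entry) \<Longrightarrow> \<rho> a = \<tau> a"
    have eq: "\<rho> ''n'' 0 = n" "\<rho> ''A'' = input_cell n E" "\<rho> ''C'' = \<tau> ''C''"
      using fr'[of "''n''"] fr'[of "''A''"] fr'[of "''C''"] fr n A by simp_all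
    have "n > 0" using i(1) by (cases n) auto
    then have lt: "i div n < n" "i mod n < n" using i(1) by (simp_all add: less_mult_imp_div_less)
    have C': "\<tau> ''C'' a \<noteq> 0 \<longleftrightarrow> (a, v) \<in> S" if "a < n" for a
      using C that mem[OF that v(2)] by (simp add: I1_def)
    have "val entry \<rho> = of_bool (\<rho> ''R'' i \<noteq> 0 \<or> P i)"
      using i(1,3) C'[OF lt(1)] C'[OF lt(2)]
      by (simp add: entry_def eq P_def input_cell_def)
    then show "wp (word_size n k) (Store ''R'' (scalar ''i'') entry)
       (\<lambda>\<tau>'. I2 (Suc i) (update \<tau>' ''i'' 0 (Suc i))) \<rho>"
      using i(1,2,3) by (intro wp_Store)
        (auto simp: I2_def update_def less_Suc_eq of_bool_less_two_power simp del: of_bool_or_iff)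
  next
    fix \<rho> assume I: "I2 (n * n) \<rho>"
    have "\<rho> ''R'' (a * n + b) \<noteq> 0 \<longleftrightarrow> (a, b) \<in> S \<or> (a, b) \<in> E \<and> (a, v) \<notin> S \<and> (b, v) \<in> S"
      if "a < n" "b < n" for a b
      using I pair_index_less[OF that] pair_index[OF that(2), of a] mem[OF that]
      by (simp add: I2_def P_def)
    moreover have "S \<subseteq> {..<n} \<times> {..<n}" by (auto simp: S_def relation_def)
    ultimately show "relation n \<rho> = S \<union> {(a, b). (a, b) \<in> E \<and> (a, v) \<notin> S \<and> (b, v) \<in> S}"
      using E by (auto simp: relation_def)
  next
    show "n * n \<le> (word_size n k + 1) ^ 5" "n * n < 2 ^ word_size n k"
      using power5_le[of n k] power5_less(1)[of n k] power5_less(2)[of n] by linarith+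
  qed (use fr n in simp_all)
  show ?thesis
    unfolding add_entering_arcs_def S_def[symmetric] entry_def[symmetric]
  proof (rule wp_Seq, rule wp_conseq[OF loop1])
    fix \<tau> assume "\<And>a. a \<notin> writes (For ''i'' (scalar ''n'')
       (Store ''C'' (scalar ''i'') (cell ''R'' (scalar ''i'') (scalar ''v'')))) \<Longrightarrow> \<tau> a = \<sigma> a" "I1 n \<tau>"
    then show "wp (word_size n k) (For ''i'' (scalar ''n'' [*] scalar ''n'') (Store ''R'' (scalar ''i'') entry))
      (\<lambda>\<tau>. relation n \<tau> = S \<union> {(a, b). (a, b) \<in> E \<and> (a, v) \<notin> S \<and> (b, v) \<in> S}) \<tau>"
      by (intro loop2) simp_all
  qed
qed

text \<open>The greedy process continues from a closure, the program from its own matrix; this lets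
  the two be compared by their closures.\<close>

lemma rtrancl_Un_rtrancl_left: "(P\<^sup>* \<union> D)\<^sup>* = (P \<union> D)\<^sup>*"
proof (rule antisym)
  show "(P\<^sup>* \<union> D)\<^sup>* \<subseteq> (P \<union> D)\<^sup>*"
    using rtrancl_mono[of "P\<^sup>* \<union> D" "(P \<union> D)\<^sup>*"] by (auto intro: in_rtrancl_UnI)
  show "(P \<union> D)\<^sup>* \<subseteq> (P\<^sup>* \<union> D)\<^sup>*" by (intro rtrancl_mono) auto
qed

text \<open>The identity makes the matrix reflexive, as \<open>wp_close_relation\<close> requires,
  and adds no reachability.\<close>

definition start_relation :: "nat \<Rightarrow> (nat \<times> nat) set \<Rightarrow> nat set \<Rightarrow> (nat \<times> nat) set" where
  "start_relation n E X = Id_on {..<n} \<union> {(a, b) \<in> E. a \<notin> X}"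

lemma writes_close_relation [simp]: "writes close_relation = {''i'', ''R''}"
  by (simp add: close_relation_def)

lemma writes_init_relation [simp]: "writes init_relation = {''i'', ''R''}"
  by (simp add: init_relation_def)

lemma writes_find_source [simp]: "writes find_source = {''i'', ''v''}"
  by (auto simp: find_source_def)

lemma writes_add_entering_arcs [simp]: "writes add_entering_arcs = {''i'', ''C'', ''R''}"
  by (auto simp: add_entering_arcs_def)

lemma relation_cong: "\<sigma> ''R'' = \<tau> ''R'' \<Longrightarrow> relation n \<sigma> = relation n \<tau>"
  by (simp add: relation_def)

text \<open>Matrix and greedy process agree only up to closure. Once the root reaches everything,
  the program keeps running its rounds and may still change the matrix, while \<open>S\<close> and
  \<open>m\<close> are frozen. Hence the invariant \<open>J\<close> has two cases: \<open>t\<close>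
  cuts with equal closures, or full reachability in both relations.\<close>

lemma wp_count_cuts:
  assumes n: "\<sigma> ''n'' 0 = n" and k: "\<sigma> ''k'' 0 = k" and r: "\<sigma> ''r'' 0 = r" "r < n"
    and A: "\<sigma> ''A'' = input_cell n E" and E: "E \<subseteq> {..<n} \<times> {..<n}"
  shows "wp (word_size n k) count_cuts
    (\<lambda>\<tau>. \<exists>S m. cut_sequence {..<n} E r (start_relation n E (sampled n \<sigma>)) S m \<and>
       \<tau> ''c'' 0 = k + m \<and> (m = n + 1 \<or> (\<forall>w < n. (r, w) \<in> S\<^sup>*))) \<sigma>"
proof -
  define S0 where "S0 = start_relation n E (sampled n \<sigma>)"
  define J where "J t \<tau> \<longleftrightarrow> (\<forall>a < n. (a, a) \<in> relation n \<tau>) \<and>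
    (\<exists>S m. cut_sequence {..<n} E r S0 S m \<and> \<tau> ''c'' 0 = k + m \<and> m \<le> t \<and>
      (m = t \<and> (relation n \<tau>)\<^sup>* = S\<^sup>* \<or>
       (\<forall>w < n. (r, w) \<in> S\<^sup>*) \<and> (\<forall>w < n. (r, w) \<in> (relation n \<tau>)\<^sup>*)))" for t and \<tau> :: state
  let ?body = "close_relation ;; find_source ;;
        ''c'' ::= scalar ''c'' [+] not_expr (cell ''R'' (scalar ''r'') (scalar ''v'')) ;;
        add_entering_arcs"
  have body: "wp (word_size n k) ?body (J (Suc t)) \<tau>"
    if t: "t < n + 1" and J: "J t \<tau>"
      and eq: "\<tau> ''n'' 0 = n" "\<tau> ''r'' 0 = r" "\<tau> ''A'' = input_cell n E" for t \<tau>
  proof -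
    define P where "P = (relation n \<tau>)\<^sup>* \<inter> {..<n} \<times> {..<n}"
    have "relation n \<tau> \<subseteq> P" by (auto simp: P_def) (auto simp: relation_def)
    then have P_star: "P\<^sup>* = (relation n \<tau>)\<^sup>*" by (intro rtrancl_subset) (auto simp: P_def)
    have P_refl: "(a, a) \<in> P" if "a < n" for a using that by (simp add: P_def)
    have "trans P" unfolding P_def by (rule transI) auto
    have P_V: "P \<subseteq> {..<n} \<times> {..<n}" by (simp add: P_def)
    show ?thesis
    proof (intro wp_Seq, rule wp_conseq[OF wp_close_relation], goal_cases)
      case 1
      then show ?case using eq by simp
    next
      case (2 a)
      then show ?case using J by (simp add: J_def)
    next
      case (3 \<tau>1)
      have R1: "relation n \<tau>1 = P" using 3(3) by (simp add: P_def)
      have eq1: "\<tau>1 ''n'' 0 = n" "\<tau>1 ''r'' 0 = r" "\<tau>1 ''A'' = input_cell n E" "\<tau>1 ''c'' = \<tau> ''c''"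
        using 3(2)[of "''n''"] 3(2)[of "''r''"] 3(2)[of "''A''"] 3(2)[of "''c''"] eq by simp_all
      show ?case
      proof (rule wp_Seq, rule wp_conseq[OF wp_find_source], goal_cases)
        case (5 \<tau>2)
        define v where "v = \<tau>2 ''v'' 0"
        have R2: "\<tau>2 ''R'' = \<tau>1 ''R''" "relation n \<tau>2 = P"
          using 5(2)[of "''R''"] R1 relation_cong[of \<tau>2 \<tau>1] by simp_all
        have eq2: "\<tau>2 ''n'' 0 = n" "\<tau>2 ''r'' 0 = r" "\<tau>2 ''A'' = input_cell n E" "\<tau>2 ''c'' = \<tau> ''c''"
          using 5(2)[of "''n''"] 5(2)[of "''r''"] 5(2)[of "''A''"] 5(2)[of "''c''"] eq1 by simp_all
        have v: "v < n" "\<And>w. w < n \<Longrightarrow> (w, v) \<in> P \<Longrightarrow> (v, w) \<in> P"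
          "\<And>w. (r, v) \<in> P \<Longrightarrow> w < n \<Longrightarrow> (r, w) \<in> P"
          using 5(3) by (auto simp: R1 eq1 v_def)
        have test: "\<tau>2 ''R'' (r * n + v) = 0 \<longleftrightarrow> (r, v) \<notin> P"
          using r(2) v(1) R2(2) by (auto simp: relation_def)
        define c where "c = \<tau> ''c'' 0 + of_bool ((r, v) \<notin> P)"
        have val_c: "val (scalar ''c'' [+] not_expr (cell ''R'' (scalar ''r'') (scalar ''v''))) \<tau>2 = c"
          using test by (simp add: eq2 c_def v_def[symmetric])
        have "\<tau> ''c'' 0 \<le> k + t" using J by (auto simp: J_def)
        then have "c < 2 ^ word_size n k" using t linear_bounds(1)[of n k] by (simp add: c_def)
        define D where "D = {(a, b). (a, b) \<in> E \<and> (a, v) \<notin> P \<and> (b, v) \<in> P}"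
        have J': "J (Suc t) \<tau>4" if R4: "relation n \<tau>4 = P \<union> D" and c4: "\<tau>4 ''c'' 0 = c" for \<tau>4
        proof -
          obtain S m where S: "cut_sequence {..<n} E r S0 S m" "\<tau> ''c'' 0 = k + m" "m \<le> t"
            and alt: "m = t \<and> (relation n \<tau>)\<^sup>* = S\<^sup>* \<or>
              (\<forall>w < n. (r, w) \<in> S\<^sup>*) \<and> (\<forall>w < n. (r, w) \<in> (relation n \<tau>)\<^sup>*)"
            using J by (auto simp: J_def)
          have refl4: "\<forall>a < n. (a, a) \<in> relation n \<tau>4" using R4 P_refl by blast
          have mono: "P\<^sup>* \<subseteq> (relation n \<tau>4)\<^sup>*" unfolding R4 by (intro rtrancl_mono) simp
          show ?thesis
          proof (cases "(r, v) \<in> P")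
            case True
            \<comment> \<open>The root reaching the chosen vertex means that it reaches everything,
              so this round counts no cut.\<close>
            have reach: "\<forall>w < n. (r, w) \<in> P" using v(3)[OF True] by blast
            then have "\<forall>w < n. (r, w) \<in> S\<^sup>*" using alt P_star by auto
            moreover have "\<forall>w < n. (r, w) \<in> (relation n \<tau>4)\<^sup>*" using reach mono by blast
            ultimately show ?thesis
              using S refl4 c4 True by (auto simp: J_def c_def intro!: exI[of _ S] exI[of _ m])
          next
            case False
            then have "(r, v) \<notin> (relation n \<tau>)\<^sup>*" using r(2) v(1) by (simp add: P_def)
            then have m: "m = t" "P\<^sup>* = S\<^sup>*" using alt v(1) P_star by auto
            have P_S: "(a, b) \<in> P \<longleftrightarrow> (a, b) \<in> S\<^sup>*" if "a < n" "b < n" for a b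
              using that m(2) P_star by (simp add: P_def)
            \<comment> \<open>A cut asks for this for all \<open>w\<close>, whereas the program has
              examined only vertices. A \<open>w\<close> other than \<open>v\<close> that reaches
              \<open>v\<close> has an arc in \<open>P\<close>, so it is a vertex.\<close>
            have "(v, w) \<in> S\<^sup>*" if "(w, v) \<in> S\<^sup>*" for w
            proof (cases "w = v")
              case False
              have "(w, v) \<in> P\<^sup>*" using that m(2) by simp
              then have "\<exists>y. (w, y) \<in> P" using False by (cases rule: converse_rtranclE) auto
              then have "w < n" using P_V by auto
              then show ?thesis using v(1,2) that P_S by blast
            qed simp
            moreover have "(r, v) \<notin> S\<^sup>*" using False r(2) v(1) P_S by blast
            ultimately have "cut_sequence {..<n} E r S0
              (S\<^sup>* \<union> {(a, b). (a, b) \<in> E \<and> (a, v) \<notin> S\<^sup>* \<and> (b, v) \<in> S\<^sup>*}) (Suc m)"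
              using S(1) v(1) by (intro cut_sequence.cut) auto
            moreover have "{(a, b). (a, b) \<in> E \<and> (a, v) \<notin> S\<^sup>* \<and> (b, v) \<in> S\<^sup>*} = D"
              using E v(1) P_S unfolding D_def by blast
            ultimately have "cut_sequence {..<n} E r S0 (S\<^sup>* \<union> D) (Suc m)" by simp
            moreover have "(relation n \<tau>4)\<^sup>* = (S\<^sup>* \<union> D)\<^sup>*"
              unfolding R4 m(2)[symmetric] by (rule rtrancl_Un_rtrancl_left[symmetric])
            ultimately show ?thesis
              using S(2) m(1) refl4 c4 False unfolding J_def c_def
              by (intro conjI exI[of _ "S\<^sup>* \<union> D"] exI[of _ "Suc m"]) auto
          qed
        qed
        show ?case
        proof (intro wp_Seq wp_Store, goal_cases)
          case 1
          then show ?case using \<open>c < 2 ^ word_size n k\<close> val_c by simp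
        next
          case 2
          show ?case unfolding val_c
          proof (rule wp_conseq[OF wp_add_entering_arcs[where n = n and v = v and E = E]], goal_cases)
            case (6 \<tau>4)
            have "\<tau>4 ''c'' 0 = c" using 6(2)[of "''c''"] by (simp add: update_def)
            moreover have "relation n \<tau>4 = P \<union> D" using 6(3) by (simp add: R2(2) D_def)
            ultimately show ?case by (rule J'[rotated])
          qed (use eq2 v(1) E in \<open>simp_all add: update_def v_def\<close>)
        qed
      qed (use eq1 r(2) R1 P_refl \<open>trans P\<close> in simp_all)
    qed
  qed
  show ?thesis
    unfolding count_cuts_def S0_def[symmetric]
  proof (intro wp_Seq wp_Store, goal_cases)
    case 1
    then show ?case using k linear_bounds(1)[of n k] by simp
  next
    case 2
    show ?case
    proof (rule wp_conseq[OF wp_init_relation[where n = n and E = E]], goal_cases)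
      case (4 \<tau>1)
      have eq1: "\<tau>1 ''n'' 0 = n" "\<tau>1 ''r'' 0 = r" "\<tau>1 ''A'' = input_cell n E" "\<tau>1 ''c'' 0 = k"
        using 4(2)[of "''n''"] 4(2)[of "''r''"] 4(2)[of "''A''"] 4(2)[of "''c''"] n r A k
        by (simp_all add: update_def)
      have R1: "relation n \<tau>1 = S0"
        using 4(3) by (simp add: S0_def start_relation_def sampled_def update_def)
      show ?case
      proof (rule wp_For[where N = "n + 1" and I = J], goal_cases)
        case 1
        have "\<forall>a < n. (a, a) \<in> S0" by (auto simp: S0_def start_relation_def)
        then show ?case using eq1 R1 cut_sequence.start[of "{..<n}" E r S0]
          by (auto simp: J_def update_def relation_cong[of "\<tau>1(_ := _)" \<tau>1])
      next
        case (2 i \<tau>)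
        have "wp (word_size n k) ?body (J (Suc i)) \<tau>"
          using 2(4)[of "''n''"] 2(4)[of "''r''"] 2(4)[of "''A''"] eq1 2(1,2) by (intro body) simp_all
        then show ?case
          by (rule wp_conseq) (simp add: J_def update_def relation_cong[of "_(_ := _)"])
      next
        case (3 \<tau>)
        then show ?case using eq1 3[of "''n''"] by simp
      next
        case (7 \<tau>)
        then show ?case by (auto simp: J_def)
      qed (use linear_bounds[of n k] in simp_all)
    qed (use n A E in \<open>simp_all add: update_def\<close>)
  qed
qed

lemma writes_count_cuts [simp]:
  "writes count_cuts = {''c'', ''i'', ''R'', ''t'', ''v'', ''C''}"
  by (auto simp: count_cuts_def)

text \<open>\<open>accepts\<close> and \<open>never_rejects\<close> bracket the outcome of the
  program, whose choice of components is not specified: the first asks for some terminated process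
  with few cuts and gives soundness, the second bounds the cuts of every process and gives
  completeness.\<close>

definition accepts :: "nat \<Rightarrow> nat \<Rightarrow> (nat \<times> nat) set \<Rightarrow> nat set \<Rightarrow> nat \<Rightarrow> bool" where
  "accepts n k E X r \<longleftrightarrow> (\<exists>S m. cut_sequence {..<n} E r (start_relation n E X) S m \<and>
     (\<forall>w < n. (r, w) \<in> S\<^sup>*) \<and> k + m \<le> card X)"

definition never_rejects :: "nat \<Rightarrow> nat \<Rightarrow> (nat \<times> nat) set \<Rightarrow> nat set \<Rightarrow> nat \<Rightarrow> bool" where
  "never_rejects n k E X r \<longleftrightarrow>
     (\<forall>S m. cut_sequence {..<n} E r (start_relation n E X) S m \<longrightarrow> k + m \<le> card X)"

lemma sampled_subset: "sampled n \<sigma> \<subseteq> {..<n}"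
  by (auto simp: sampled_def)

lemma card_sampled_le: "card (sampled n \<sigma>) \<le> n"
  using card_mono[OF _ sampled_subset, of n \<sigma>] by simp

lemma wp_try_roots:
  assumes n: "\<sigma> ''n'' 0 = n" and k: "\<sigma> ''k'' 0 = k" and A: "\<sigma> ''A'' = input_cell n E"
    and E: "E \<subseteq> {..<n} \<times> {..<n}" and out: "\<sigma> ''out'' 0 = 0"
    and s: "\<sigma> ''s'' 0 = card (sampled n \<sigma>)"
  shows "wp (word_size n k) (For ''r'' (scalar ''n'')
      (count_cuts ;; ''out'' ::= or_expr (scalar ''out'') (scalar ''c'' [<] scalar ''s'' [+] Const 1)))
    (\<lambda>\<tau>. (\<tau> ''out'' 0 \<noteq> 0 \<longrightarrow> (\<exists>r < n. accepts n k E (sampled n \<sigma>) r)) \<and>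
      ((\<exists>r < n. never_rejects n k E (sampled n \<sigma>) r) \<longrightarrow> \<tau> ''out'' 0 \<noteq> 0)) \<sigma>"
proof -
  define X where "X = sampled n \<sigma>"
  define I where "I i \<tau> \<longleftrightarrow> (\<tau> ''out'' 0 \<noteq> 0 \<longrightarrow> (\<exists>r < n. accepts n k E X r)) \<and>
      ((\<exists>r < i. never_rejects n k E X r) \<longrightarrow> \<tau> ''out'' 0 \<noteq> 0)" for i and \<tau> :: state
  show ?thesis
    unfolding X_def[symmetric]
  proof (rule wp_For[where N = n and I = I], goal_cases)
    case 1
    then show ?case using out by (simp add: I_def update_def)
  next
    case (2 i \<tau>)
    have eq: "\<tau> ''n'' 0 = n" "\<tau> ''k'' 0 = k" "\<tau> ''A'' = input_cell n E" "\<tau> ''s'' 0 = card X"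
      using 2(4)[of "''n''"] 2(4)[of "''k''"] 2(4)[of "''A''"] 2(4)[of "''s''"] n k A s
      by (simp_all add: X_def)
    have X: "sampled n \<tau> = X" using 2(4)[of "''X''"] by (simp add: sampled_def X_def)
    show ?case
    proof (rule wp_Seq, rule wp_conseq[OF wp_count_cuts[where n = n and k = k and r = i and E = E]], goal_cases)
      case (7 \<tau>1)
      then obtain S m where S: "cut_sequence {..<n} E i (start_relation n E X) S m"
        "\<tau>1 ''c'' 0 = k + m" "m = n + 1 \<or> (\<forall>w < n. (i, w) \<in> S\<^sup>*)"
        using X by auto
      have eq1: "\<tau>1 ''s'' 0 = card X" "\<tau>1 ''out'' = \<tau> ''out''"
        using 7(2)[of "''s''"] 7(2)[of "''out''"] eq by simp_all
      have test: "val (or_expr (scalar ''out'') (scalar ''c'' [<] scalar ''s'' [+] Const 1)) \<tau>1 =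
          of_bool (\<tau> ''out'' 0 \<noteq> 0 \<or> k + m \<le> card X)"
        using eq1 S(2) by (simp add: less_Suc_eq_le)
      \<comment> \<open>A sample has at most \<open>n\<close> elements, so a count of
        \<open>n + 1\<close> cuts cannot pass the test; passing it implies that the process
        terminated.\<close>
      have "accepts n k E X i" if "k + m \<le> card X"
        using that S(1,3) card_sampled_le[of n \<sigma>] unfolding accepts_def X_def by fastforce
      moreover have "k + m \<le> card X" if "never_rejects n k E X i"
        using that S(1) unfolding never_rejects_def by blast
      ultimately have "I (Suc i) (update (update \<tau>1 ''out'' 0 (of_bool (\<tau> ''out'' 0 \<noteq> 0 \<or> k + m \<le> card X))) ''r'' 0 (Suc i))"
        using 2(1,2) by (auto simp: I_def update_def less_Suc_eq)
      then show ?case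
        using test by (intro wp_Store) (simp_all add: of_bool_less_two_power del: of_bool_or_iff)
    qed (use eq E 2 in simp_all)
  next
    case (3 \<tau>)
    then show ?case using n 3[of "''n''"] by simp
  next
    case (7 \<tau>)
    then show ?case by (simp add: I_def)
  qed (use linear_bounds[of n k] in simp_all)
qed

lemma wp_sample:
  assumes n: "\<sigma> ''n'' 0 = n"
  shows "wp (word_size n k) sample (\<lambda>\<tau>. \<tau> ''s'' 0 = card (sampled n \<tau>)) \<sigma>"
proof -
  \<comment> \<open>Only cells below \<open>i\<close> are counted, since the others may still hold
    the previous sample.\<close>
  define I where "I i \<tau> \<longleftrightarrow> \<tau> ''s'' 0 = card {a. a < i \<and> \<tau> ''X'' a \<noteq> 0}" for i and \<tau> :: state
  show ?thesis
    unfolding sample_def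
  proof (intro wp_Seq wp_Store, goal_cases)
    case 2
    show ?case
    proof (rule wp_For[where N = n and I = I], goal_cases)
      case (2 i \<tau>)
      have "card {a. a < i \<and> \<tau> ''X'' a \<noteq> 0} \<le> i"
        using card_mono[of "{..<i}" "{a. a < i \<and> \<tau> ''X'' a \<noteq> 0}"] by auto
      then have bound: "\<tau> ''s'' 0 + 1 < 2 ^ word_size n k"
        using 2(1,2) linear_bounds(1)[of n k] by (simp add: I_def)
      have "I (Suc i) (update (update (update \<tau> ''X'' i (of_bool b)) ''s'' 0 (\<tau> ''s'' 0 + of_bool b)) ''i'' 0 (Suc i))" for b
      proof -
        have "{a. a < Suc i \<and> (update \<tau> ''X'' i (of_bool b)) ''X'' a \<noteq> 0} =
            {a. a < i \<and> \<tau> ''X'' a \<noteq> 0} \<union> (if b then {i} else {})"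
          by (auto simp: update_def less_Suc_eq)
        then show ?thesis using 2(2) by (auto simp: I_def update_def)
      qed
      then show ?case using bound 2(3)
        by (intro wp_Seq wp_Flip wp_Store) (auto simp: update_def)
    next
      case (3 \<tau>)
      then show ?case using n 3[of "''n''"] by (simp add: update_def)
    next
      case (7 \<tau>)
      then show ?case by (simp add: I_def sampled_def)
    qed (use linear_bounds[of n k] in \<open>simp_all add: I_def update_def\<close>)
  qed simp
qed


section \<open>Success probabilities\<close>

abbreviation (input) expect :: "'a pmf \<Rightarrow> ('a \<Rightarrow> real) \<Rightarrow> real" where
  "expect p f \<equiv> measure_pmf.expectation p f"

lemma expect_bind:
  assumes "finite (set_pmf p)" "\<And>x. x \<in> set_pmf p \<Longrightarrow> finite (set_pmf (q x))"
  shows "expect (bind_pmf p q) f = expect p (\<lambda>x. expect (q x) f)"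
  using pmf_expectation_bind[OF assms order_refl, where h = f] integral_measure_pmf[OF assms(1), where M = p and f = "\<lambda>x. expect (q x) f"]
  by simp

lemma expect_mono:
  assumes "finite (set_pmf p)" "\<And>x. x \<in> set_pmf p \<Longrightarrow> f x \<le> g x"
  shows "expect p f \<le> expect p g"
  using assms by (intro integral_mono_AE integrable_measure_pmf_finite AE_pmfI)

lemma expect_linear:
  assumes "finite (set_pmf p)"
  shows "expect p (\<lambda>x. a + f x * b) = a + expect p f * b"
  using assms by (simp add: integrable_measure_pmf_finite)

text \<open>With probabilities written as expectations, the error, the expected time and the tail
  all go through the same recursion in the main loop.\<close>

lemma prob_eq_expect: "measure_pmf.prob p {x. P x} = expect p (\<lambda>x. of_bool (P x))"
proof -
  have "measure_pmf.prob p {x. P x} = expect p (indicator {x. P x})" by simp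
  also have "\<dots> = expect p (\<lambda>x. of_bool (P x))"
    by (intro Bochner_Integration.integral_cong) (auto simp: indicator_def)
  finally show ?thesis .
qed

lemma expect_delay: "expect (delay t p) f = expect p (\<lambda>x. f (fst x, t + snd x))"
  by (simp add: delay_def case_prod_beta)

lemma finite_set_delay: "finite (set_pmf p) \<Longrightarrow> finite (set_pmf (delay t p))"
  by (simp add: delay_def)

lemma expect_sequence:
  assumes "finite (set_pmf p)" "\<And>x. x \<in> set_pmf p \<Longrightarrow> finite (set_pmf (q (fst x)))"
  shows "expect (bind_pmf p (\<lambda>(\<sigma>, t). delay t (q \<sigma>))) f =
    expect p (\<lambda>x. expect (q (fst x)) (\<lambda>y. f (fst y, snd x + snd y)))"
proof -
  have "expect (bind_pmf p (\<lambda>x. delay (snd x) (q (fst x)))) f =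
      expect p (\<lambda>x. expect (delay (snd x) (q (fst x))) f)"
    using assms by (intro expect_bind finite_set_delay)
  moreover have "(\<lambda>(\<sigma>, t). delay t (q \<sigma>)) = (\<lambda>x. delay (snd x) (q (fst x)))" by auto
  ultimately show ?thesis by (simp add: expect_delay)
qed

text \<open>This does not assert that a run exists; existence comes from \<open>wp\<close>. By
  \<open>exec_deterministic\<close> both speak about the same distribution.\<close>

definition probably :: "com \<Rightarrow> real \<Rightarrow> (state \<Rightarrow> bool) \<Rightarrow> state \<Rightarrow> bool" where
  "probably c a Q \<sigma> \<longleftrightarrow> (\<forall>p. exec c \<sigma> p \<longrightarrow> a \<le> expect p (\<lambda>x. of_bool (Q (fst x))))"

text \<open>Facts established by \<open>wp\<close> hold for every outcome, so they can be conjoined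
  without lowering the probability.\<close>

lemma probably_wp:
  assumes "bounded_state L \<sigma>" "wp L c Q' \<sigma>" "probably c a Q \<sigma>"
    "\<And>\<tau>. bounded_state L \<tau> \<Longrightarrow> (\<And>a. a \<notin> writes c \<Longrightarrow> \<tau> a = \<sigma> a) \<Longrightarrow> Q \<tau> \<Longrightarrow> Q' \<tau> \<Longrightarrow> Q'' \<tau>"
  shows "probably c a Q'' \<sigma>"
  unfolding probably_def
proof (intro allI impI)
  fix p assume p: "exec c \<sigma> p"
  obtain p' where p': "exec c \<sigma> p'"
    "\<And>x. x \<in> set_pmf p' \<Longrightarrow> bounded_state L (fst x) \<and> Q' (fst x) \<and> snd x \<le> time_bound c L"
    using wpE[OF assms(2,1)] by blast
  have "p' = p" using exec_deterministic p p'(1) by blast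
  have "a \<le> expect p (\<lambda>x. of_bool (Q (fst x)))" using assms(3) p by (simp add: probably_def)
  also have "\<dots> \<le> expect p (\<lambda>x. of_bool (Q'' (fst x)))"
    using assms(4) p'(2) exec_unwritten[OF p] exec_finite_support[OF p] unfolding \<open>p' = p\<close>
    by (intro expect_mono) auto
  finally show "a \<le> expect p (\<lambda>x. of_bool (Q'' (fst x)))" .
qed

section \<open>Rules for lower bounds on success probabilities\<close>

lemma probably_mono:
  assumes "probably c a Q \<sigma>" "\<And>\<tau>. Q \<tau> \<Longrightarrow> Q' \<tau>"
  shows "probably c a Q' \<sigma>"
  unfolding probably_def
proof (intro allI impI)
  fix p assume p: "exec c \<sigma> p"
  have "a \<le> expect p (\<lambda>x. of_bool (Q (fst x)))" using assms(1) p by (simp add: probably_def)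
  also have "\<dots> \<le> expect p (\<lambda>x. of_bool (Q' (fst x)))"
    using assms(2) exec_finite_support[OF p] by (intro expect_mono) auto
  finally show "a \<le> expect p (\<lambda>x. of_bool (Q' (fst x)))" .
qed

lemma probably_bind:
  assumes "finite (set_pmf p)" "\<And>x. x \<in> set_pmf p \<Longrightarrow> exec d (fst x) (q (fst x))"
    "a \<le> expect p (\<lambda>x. of_bool (R (fst x)))" "\<And>\<tau>. R \<tau> \<Longrightarrow> probably d b Q \<tau>" "0 \<le> b"
  shows "a * b \<le> expect (bind_pmf p (\<lambda>(\<sigma>, t). delay t (q \<sigma>))) (\<lambda>x. of_bool (Q (fst x)))"
proof -
  have "a * b \<le> expect p (\<lambda>x. of_bool (R (fst x))) * b" using assms(3,5) by (rule mult_right_mono)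
  also have "\<dots> = expect p (\<lambda>x. of_bool (R (fst x)) * b)" by simp
  also have "\<dots> \<le> expect p (\<lambda>x. expect (q (fst x)) (\<lambda>y. of_bool (Q (fst y))))"
    using assms(1,2,4) by (intro expect_mono) (auto simp: probably_def)
  also have "\<dots> = expect (bind_pmf p (\<lambda>(\<sigma>, t). delay t (q \<sigma>))) (\<lambda>x. of_bool (Q (fst x)))"
    using assms(1) exec_finite_support[OF assms(2)] by (subst expect_sequence) simp_all
  finally show ?thesis .
qed

lemma probably_Seq:
  assumes "probably c a R \<sigma>" "\<And>\<tau>. R \<tau> \<Longrightarrow> probably d b Q \<tau>" "0 \<le> b"
  shows "probably (Seq c d) (a * b) Q \<sigma>"
  unfolding probably_def
proof (intro allI impI)
  fix p assume "exec (Seq c d) \<sigma> p"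
  then show "a * b \<le> expect p (\<lambda>x. of_bool (Q (fst x)))"
  proof (rule SeqE)
    fix p1 q assume p: "p = bind_pmf p1 (\<lambda>(\<sigma>', t). delay t (q \<sigma>'))" "exec c \<sigma> p1"
      "\<forall>x \<in> set_pmf p1. exec d (fst x) (q (fst x))"
    show ?thesis
      unfolding p(1) using p(2,3) assms exec_finite_support[OF p(2)]
      by (intro probably_bind[where R = R]) (auto simp: probably_def)
  qed
qed

lemma probably_While_true:
  assumes "val e \<sigma> \<noteq> 0" "probably c a R \<sigma>" "\<And>\<tau>. R \<tau> \<Longrightarrow> probably (While e c) b Q \<tau>" "0 \<le> b"
  shows "probably (While e c) (a * b) Q \<sigma>"
  unfolding probably_def
proof (intro allI impI)
  fix p assume "exec (While e c) \<sigma> p"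
  then show "a * b \<le> expect p (\<lambda>x. of_bool (Q (fst x)))"
  proof (rule WhileE)
    fix p1 q assume p: "p = delay (Suc (cost e \<sigma>)) (bind_pmf p1 (\<lambda>(\<sigma>', t). delay t (q \<sigma>')))" "exec c \<sigma> p1"
      "\<forall>x \<in> set_pmf p1. exec (While e c) (fst x) (q (fst x))"
    have "a * b \<le> expect (bind_pmf p1 (\<lambda>(\<sigma>', t). delay t (q \<sigma>'))) (\<lambda>x. of_bool (Q (fst x)))"
      using p(2,3) assms exec_finite_support[OF p(2)]
      by (intro probably_bind[where R = R]) (auto simp: probably_def)
    then show ?thesis unfolding p(1) expect_delay by simp
  qed (use assms(1) in simp)
qed

lemma probably_While_false:
  assumes "val e \<sigma> = 0" "Q \<sigma>"
  shows "probably (While e c) 1 Q \<sigma>"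
  unfolding probably_def
proof (intro allI impI)
  fix p assume "exec (While e c) \<sigma> p"
  then show "1 \<le> expect p (\<lambda>x. of_bool (Q (fst x)))"
    by (rule WhileE) (use assms in simp_all)
qed

lemma probably_Store: "Q (update \<sigma> a (val d \<sigma>) (val e \<sigma>)) \<Longrightarrow> probably (Store a d e) 1 Q \<sigma>"
  unfolding probably_def by (auto elim!: StoreE)

lemma probably_Flip:
  assumes "Q (update \<sigma> a (val d \<sigma>) (of_bool b))"
  shows "probably (Flip a d) (1 / 2) Q \<sigma>"
  unfolding probably_def using assms by (cases b) (auto elim!: FlipE)

lemma probably_Flip_sure:
  assumes "\<And>b. Q (update \<sigma> a (val d \<sigma>) (of_bool b))"
  shows "probably (Flip a d) 1 Q \<sigma>"
  unfolding probably_def using assms[of True] assms[of False] by (auto elim!: FlipE)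

text \<open>Independence of the flips enters through the product in the sequencing rule: a flip for
  a vertex of \<open>D\<close> must come out as prescribed by \<open>K\<close> and contributes 1/2,
  every other flip contributes 1.\<close>

lemma probably_sample:
  assumes n: "\<sigma> ''n'' 0 = n" and D: "D \<subseteq> {..<n}"
  shows "probably sample ((1 / 2) ^ card D) (\<lambda>\<tau>. sampled n \<tau> \<inter> D = K \<inter> D) \<sigma>"
proof -
  let ?s = "''s'' ::= scalar ''s'' [+] Load ''X'' (scalar ''i'')"
  let ?i = "''i'' ::= scalar ''i'' [+] Const 1"
  let ?body = "(Flip ''X'' (scalar ''i'') ;; ?s) ;; ?i"
  let ?loop = "While (scalar ''i'' [<] scalar ''n'') ?body"
  define I where "I i \<tau> \<longleftrightarrow> \<tau> ''n'' 0 = n \<and> \<tau> ''i'' 0 = i \<and>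
    (\<forall>j \<in> D. j < i \<longrightarrow> (\<tau> ''X'' j \<noteq> 0 \<longleftrightarrow> j \<in> K))" for i and \<tau> :: state
  have body: "probably ?body (if i \<in> D then 1 / 2 else 1) (I (Suc i)) \<tau>" if "I i \<tau>" for i \<tau>
  proof -
    define R where "R \<rho> \<longleftrightarrow> \<rho> ''n'' 0 = n \<and> \<rho> ''i'' 0 = i \<and>
      (\<forall>j \<in> D. j < Suc i \<longrightarrow> (\<rho> ''X'' j \<noteq> 0 \<longleftrightarrow> j \<in> K))" for \<rho> :: state
    have flip: "probably (Flip ''X'' (scalar ''i'')) (if i \<in> D then 1 / 2 else 1) R \<tau>"
    proof (cases "i \<in> D")
      case True
      have "R (update \<tau> ''X'' (val (scalar ''i'') \<tau>) (of_bool (i \<in> K)))"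
        using that by (auto simp: R_def I_def update_def)
      from probably_Flip[of R \<tau> "''X''" "scalar ''i''" "i \<in> K", OF this] show ?thesis using True by simp
    next
      case False
      then have "R (update \<tau> ''X'' (val (scalar ''i'') \<tau>) (of_bool b))" for b
        using that by (auto simp: R_def I_def update_def less_Suc_eq)
      then show ?thesis using False by (auto intro: probably_Flip_sure)
    qed
    have s: "probably ?s 1 R \<rho>" if "R \<rho>" for \<rho>
      using that by (intro probably_Store) (simp add: R_def update_def)
    have i: "probably ?i 1 (I (Suc i)) \<rho>" if "R \<rho>" for \<rho>
      using that by (intro probably_Store) (simp add: R_def I_def update_def)
    show ?thesis using probably_Seq[OF probably_Seq[OF flip s] i] by simp
  qed
  \<comment> \<open>The induction is on the number \<open>d\<close> of flips left; only the vertices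
    of \<open>D\<close> still to come are charged.\<close>
  have loop: "probably ?loop ((1 / 2) ^ card (D \<inter> {n - d..<n})) (I n) \<tau>"
    if "I (n - d) \<tau>" "d \<le> n" for d \<tau>
    using that
  proof (induction d arbitrary: \<tau>)
    case 0
    then show ?case by (auto simp: I_def intro: probably_While_false)
  next
    case (Suc d)
    define i where "i = n - Suc d"
    have i: "Suc i = n - d" "i < n" using Suc.prems(2) by (auto simp: i_def)
    have fin: "finite (D \<inter> {n - d..<n})" by simp
    have "D \<inter> {i..<n} = (if i \<in> D then insert i (D \<inter> {n - d..<n}) else D \<inter> {n - d..<n})"
      using i by (auto simp flip: i(1) simp: le_less_Suc_eq Suc_le_eq) (use le_neq_implies_less in blast)+
    then have card: "(1 / 2 :: real) ^ card (D \<inter> {i..<n}) =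
        (if i \<in> D then 1 / 2 else 1) * (1 / 2) ^ card (D \<inter> {n - d..<n})"
      using i by simp
    have "probably ?loop ((if i \<in> D then 1 / 2 else 1) * (1 / 2) ^ card (D \<inter> {n - d..<n})) (I n) \<tau>"
    proof (rule probably_While_true)
      show "val (scalar ''i'' [<] scalar ''n'') \<tau> \<noteq> 0"
        using Suc.prems(1) i(2) by (simp add: I_def i_def)
      show "probably ?body (if i \<in> D then 1 / 2 else 1) (I (n - d)) \<tau>"
        using body[of i \<tau>] Suc.prems(1) i(1) by (simp add: i_def)
    qed (use Suc in simp_all)
    then show ?case using card by (simp add: i_def)
  qed
  have "D \<inter> {n - n..<n} = D" using D by auto
  then have "probably ?loop ((1 / 2) ^ card D) (I n) \<tau>" if "I 0 \<tau>" for \<tau>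
    using loop[of n \<tau>] that by simp
  then have "probably (''i'' ::= Const 0 ;; ?loop) (1 * (1 / 2) ^ card D) (I n) \<tau>"
    if "\<tau> ''n'' 0 = n" for \<tau>
    using that by (intro probably_Seq[where R = "I 0"] probably_Store) (simp_all add: I_def update_def)
  then have "probably (''s'' ::= Const 0 ;; ''i'' ::= Const 0 ;; ?loop) (1 * (1 * (1 / 2) ^ card D)) (I n) \<sigma>"
    by (intro probably_Seq[where R = "\<lambda>\<tau>. \<tau> ''n'' 0 = n" and b = "1 * (1 / 2) ^ card D", OF probably_Store])
      (simp_all add: n update_def)
  then have "probably sample ((1 / 2) ^ card D) (I n) \<sigma>" by (simp add: sample_def For_def)
  then show ?thesis
    by (rule probably_mono) (use D in \<open>auto simp: I_def sampled_def\<close>)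
qed

section \<open>One trial and the repetition of trials\<close>

lemma writes_sample [simp]: "writes sample = {''s'', ''i'', ''X''}"
  by (auto simp: sample_def)

lemma writes_trial [simp]:
  "writes trial = {''s'', ''i'', ''X'', ''r'', ''c'', ''R'', ''t'', ''v'', ''C'', ''out''}"
  by (auto simp: trial_def)

locale instance_state =
  fixes n k :: nat and E :: "(nat \<times> nat) set" and L :: nat
  assumes E: "E \<subseteq> {..<n} \<times> {..<n}"
  defines "L \<equiv> word_size n k"
begin

definition holds :: "state \<Rightarrow> bool" where
  "holds \<sigma> \<longleftrightarrow> bounded_state L \<sigma> \<and> \<sigma> ''n'' 0 = n \<and> \<sigma> ''k'' 0 = k \<and> \<sigma> ''A'' = input_cell n E"

lemma wp_trial_roots:
  assumes "holds \<sigma>" "\<sigma> ''out'' 0 = 0" "\<sigma> ''s'' 0 = card (sampled n \<sigma>)"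
  shows "wp L (For ''r'' (scalar ''n'')
      (count_cuts ;; ''out'' ::= or_expr (scalar ''out'') (scalar ''c'' [<] scalar ''s'' [+] Const 1)))
    (\<lambda>\<tau>. (\<tau> ''out'' 0 \<noteq> 0 \<longrightarrow> (\<exists>r < n. accepts n k E (sampled n \<sigma>) r)) \<and>
      ((\<exists>r < n. never_rejects n k E (sampled n \<sigma>) r) \<longrightarrow> \<tau> ''out'' 0 \<noteq> 0)) \<sigma>"
  using wp_try_roots assms E unfolding L_def holds_def by blast

lemma wp_trial:
  assumes "holds \<sigma>" "\<sigma> ''out'' 0 = 0"
  shows "wp L trial
    (\<lambda>\<tau>. \<tau> ''out'' 0 \<noteq> 0 \<longrightarrow> (\<exists>X \<subseteq> {..<n}. \<exists>r < n. accepts n k E X r)) \<sigma>"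
  unfolding trial_def
proof (rule wp_Seq, unfold L_def, rule wp_conseq[OF wp_sample, folded L_def], goal_cases)
  case 1
  then show ?case using assms by (simp add: holds_def)
next
  case (2 \<tau>)
  have "holds \<tau>" "\<tau> ''out'' 0 = 0"
    using 2(1) 2(2)[of "''n''"] 2(2)[of "''k''"] 2(2)[of "''A''"] 2(2)[of "''out''"] assms
    by (simp_all add: holds_def L_def)
  from wp_trial_roots[OF this 2(3)] show ?case
    unfolding L_def by (rule wp_conseq) (use sampled_subset[of n \<tau>] in blast)
qed

text \<open>All the loss is in the sampling: once the sample agrees with \<open>K\<close> on
  \<open>D\<close>, some root is never rejected and the deterministic rest of the trial sets
  \<open>out\<close> for certain.\<close>

lemma probably_trial:
  assumes "holds \<sigma>" "\<sigma> ''out'' 0 = 0" "D \<subseteq> {..<n}"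
    "\<And>X. X \<subseteq> {..<n} \<Longrightarrow> X \<inter> D = K \<inter> D \<Longrightarrow> \<exists>r < n. never_rejects n k E X r"
  shows "probably trial ((1 / 2) ^ card D) (\<lambda>\<tau>. \<tau> ''out'' 0 \<noteq> 0) \<sigma>"
proof -
  define R where "R \<tau> \<longleftrightarrow> holds \<tau> \<and> \<tau> ''out'' 0 = 0 \<and> \<tau> ''s'' 0 = card (sampled n \<tau>) \<and>
    sampled n \<tau> \<inter> D = K \<inter> D" for \<tau>
  have n: "\<sigma> ''n'' 0 = n" and b: "bounded_state L \<sigma>" using assms(1) by (simp_all add: holds_def)
  have "probably sample ((1 / 2) ^ card D) R \<sigma>"
  proof (rule probably_wp[OF b wp_sample[of \<sigma> n k, OF n, folded L_def] probably_sample[of \<sigma> n D K, OF n assms(3)]])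
    fix \<tau> assume "bounded_state L \<tau>" "\<And>a. a \<notin> writes sample \<Longrightarrow> \<tau> a = \<sigma> a"
      "sampled n \<tau> \<inter> D = K \<inter> D" "\<tau> ''s'' 0 = card (sampled n \<tau>)"
    then show "R \<tau>" using assms(1,2) by (simp add: R_def holds_def)
  qed
  moreover have "probably (For ''r'' (scalar ''n'')
      (count_cuts ;; ''out'' ::= or_expr (scalar ''out'') (scalar ''c'' [<] scalar ''s'' [+] Const 1)))
      1 (\<lambda>\<tau>. \<tau> ''out'' 0 \<noteq> 0) \<tau>" if "R \<tau>" for \<tau>
  proof -
    have *: "holds \<tau>" "\<tau> ''out'' 0 = 0" "\<tau> ''s'' 0 = card (sampled n \<tau>)"
      using that by (simp_all add: R_def)
    have "\<exists>r < n. never_rejects n k E (sampled n \<tau>) r"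
      using that by (intro assms(4)) (auto simp: R_def sampled_def)
    moreover have "probably c 1 (\<lambda>_. True) \<tau>" for c
      by (simp add: probably_def)
    ultimately show ?thesis
      using wp_trial_roots[OF *] * probably_wp[of L \<tau> _ _ 1 "\<lambda>_. True" "\<lambda>\<tau>. \<tau> ''out'' 0 \<noteq> 0"]
      unfolding holds_def by blast
  qed
  ultimately have "probably trial ((1 / 2) ^ card D * 1) (\<lambda>\<tau>. \<tau> ''out'' 0 \<noteq> 0) \<sigma>"
    unfolding trial_def by (rule probably_Seq) simp_all
  then show ?thesis by simp
qed

end

lemma val_guard: "val guard \<sigma> = \<sigma> ''cap'' 0 * of_bool (\<sigma> ''out'' 0 = 0)"
  by (simp add: guard_def)

text \<open>
  The number of rounds until the first success is dominated by a geometric distribution with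
  parameter \<open>p\<close>.
\<close>

lemma (in instance_state) main_loop:
  fixes p :: real and yes :: bool
  assumes sound: "\<And>X r. X \<subseteq> {..<n} \<Longrightarrow> r < n \<Longrightarrow> accepts n k E X r \<Longrightarrow> yes"
    and p: "0 < p" "p \<le> 1"
    and hit: "\<And>\<sigma>. yes \<Longrightarrow> holds \<sigma> \<Longrightarrow> \<sigma> ''out'' 0 = 0 \<Longrightarrow> probably trial p (\<lambda>\<tau>. \<tau> ''out'' 0 \<noteq> 0) \<sigma>"
    and \<sigma>: "holds \<sigma>" "\<sigma> ''cap'' 0 = c" "\<sigma> ''out'' 0 \<noteq> 0 \<longrightarrow> yes"
  defines "e \<equiv> real (cost_bound guard L + 1)"
    and "T \<equiv> real (cost_bound guard L + 1 + time_bound attempt L)"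
    and "a \<equiv> of_bool (\<sigma> ''out'' 0 = 0)"
  shows "\<exists>q. exec (While guard attempt) \<sigma> q \<and> (\<forall>x \<in> set_pmf q. answers_yes (fst x) \<longrightarrow> yes) \<and>
    (yes \<longrightarrow>
      expect q (\<lambda>x. of_bool (\<not> answers_yes (fst x))) \<le> a * (1 - p) ^ c \<and>
      expect q (\<lambda>x. real (snd x)) \<le> e + a * (T / p) \<and>
      (\<forall>j. expect q (\<lambda>x. of_bool (real (snd x) > e + T * real j)) \<le> a * (1 - p) ^ j))"
  using \<sigma> unfolding a_def
proof (induction c arbitrary: \<sigma>)
  case (0 \<sigma>)
  have T: "0 \<le> T" by (simp add: T_def)
  have cost: "real (cost guard \<sigma> + 1) \<le> e" using 0(1) cost_le[of L \<sigma> guard] by (simp add: e_def holds_def)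
  have "exec (While guard attempt) \<sigma> (return_pmf (\<sigma>, cost guard \<sigma> + 1))"
    using 0 by (intro exec.While_false) (simp add: val_guard)
  moreover have "\<not> e + T * real j < real (cost guard \<sigma> + 1)" for j
    using cost mult_nonneg_nonneg[OF T, of "real j"] by simp
  moreover have "real (cost guard \<sigma> + 1) \<le> e + of_bool (\<sigma> ''out'' 0 = 0) * (T / p)"
    using cost T p by (cases "\<sigma> ''out'' 0 = 0") (simp_all add: add_increasing2)
  ultimately show ?case
    using 0 p by (intro exI[of _ "return_pmf (\<sigma>, cost guard \<sigma> + 1)"])
      (simp add: answers_yes_def)
next
  case (Suc c \<sigma>)
  have T: "0 \<le> T" by (simp add: T_def)
  have cost: "real (cost guard \<sigma> + 1) \<le> e" using Suc.prems(1) cost_le[of L \<sigma> guard] by (simp add: e_def holds_def)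
  show ?case
  proof (cases "\<sigma> ''out'' 0 = 0")
    case False
    then have "exec (While guard attempt) \<sigma> (return_pmf (\<sigma>, cost guard \<sigma> + 1))"
      by (intro exec.While_false) (simp add: val_guard)
    moreover have "\<not> e + T * real j < 1 + real (cost guard \<sigma>)" for j
      using cost mult_nonneg_nonneg[OF T, of "real j"] by simp
    ultimately show ?thesis
      using Suc.prems p T cost False by (intro exI[of _ "return_pmf (\<sigma>, cost guard \<sigma> + 1)"])
        (simp add: answers_yes_def)
  next
    case True
    define \<sigma>1 where "\<sigma>1 = update \<sigma> ''cap'' 0 c"
    have "c < 2 ^ L" using Suc.prems(1,2) unfolding holds_def bounded_state_def
      by (metis Suc_lessD)
    then have \<sigma>1: "holds \<sigma>1" "\<sigma>1 ''out'' 0 = 0" "\<sigma>1 ''cap'' 0 = c"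
      using Suc.prems(1) True by (simp_all add: \<sigma>1_def holds_def bounded_state_update) (simp_all add: update_def)
    have \<sigma>1_eq: "update \<sigma> ''cap'' (val (Const 0) \<sigma>) (val (scalar ''cap'' [-] Const 1) \<sigma>) = \<sigma>1"
      using Suc.prems(2) by (simp add: \<sigma>1_def)
    define inv where "inv \<tau> \<longleftrightarrow> holds \<tau> \<and> \<tau> ''cap'' 0 = c \<and> (\<tau> ''out'' 0 \<noteq> 0 \<longrightarrow> yes)" for \<tau>
    have "wp L attempt inv \<sigma>"
      unfolding attempt_def
    proof (intro wp_Seq wp_Store, unfold \<sigma>1_eq)
      show "val (scalar ''cap'' [-] Const 1) \<sigma> < 2 ^ L" using \<open>c < 2 ^ L\<close> Suc.prems(2) by simp
      show "wp L trial inv \<sigma>1"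
      proof (rule wp_conseq[OF wp_trial[OF \<sigma>1(1,2)]], goal_cases)
        case (1 \<tau>)
        then show ?case
          using 1(2)[of "''n''"] 1(2)[of "''k''"] 1(2)[of "''A''"] 1(2)[of "''cap''"] \<sigma>1 sound
          by (auto simp: inv_def holds_def)
      qed
    qed
    then obtain q1 where q1: "exec attempt \<sigma> q1"
      "\<And>x. x \<in> set_pmf q1 \<Longrightarrow> bounded_state L (fst x) \<and> inv (fst x) \<and> snd x \<le> time_bound attempt L"
      using wpE[of L attempt inv \<sigma>] Suc.prems(1) unfolding holds_def by blast
    have fin1: "finite (set_pmf q1)" by (rule exec_finite_support[OF q1(1)])
    define \<phi> :: "state \<Rightarrow> (state \<times> nat) pmf \<Rightarrow> bool" where
      "\<phi> \<tau> q \<longleftrightarrow> (\<forall>x \<in> set_pmf q. answers_yes (fst x) \<longrightarrow> yes) \<and>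
        (yes \<longrightarrow>
          expect q (\<lambda>x. of_bool (\<not> answers_yes (fst x))) \<le> of_bool (\<tau> ''out'' 0 = 0) * (1 - p) ^ c \<and>
          expect q (\<lambda>x. real (snd x)) \<le> e + of_bool (\<tau> ''out'' 0 = 0) * (T / p) \<and>
          (\<forall>j. expect q (\<lambda>x. of_bool (real (snd x) > e + T * real j)) \<le> of_bool (\<tau> ''out'' 0 = 0) * (1 - p) ^ j))"
      for \<tau> q
    have "\<forall>x \<in> set_pmf q1. \<exists>q. exec (While guard attempt) (fst x) q \<and> \<phi> (fst x) q"
      using q1(2) Suc.IH unfolding inv_def \<phi>_def by blast
    moreover have "val guard \<sigma> \<noteq> 0" using True Suc.prems(2) by (simp add: val_guard)
    ultimately obtain q2 where
      q2: "\<forall>x \<in> set_pmf q1. exec (While guard attempt) (fst x) (q2 (fst x)) \<and> \<phi> (fst x) (q2 (fst x))"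
      and ex: "exec (While guard attempt) \<sigma>
        (delay (cost guard \<sigma> + 1) (bind_pmf q1 (\<lambda>(\<sigma>', t). delay t (q2 \<sigma>'))))" (is "exec _ _ ?q")
      using exec_While_true[of guard \<sigma> attempt q1 \<phi>] q1(1) by metis
    have fin2: "finite (set_pmf (q2 (fst x)))" if "x \<in> set_pmf q1" for x
      using q2 that exec_finite_support by blast
    have expect_q: "expect ?q f =
        expect q1 (\<lambda>x. expect (q2 (fst x)) (\<lambda>y. f (fst y, cost guard \<sigma> + 1 + (snd x + snd y))))" for f
      unfolding expect_delay
      using expect_sequence[of q1 q2 "\<lambda>x. f (fst x, cost guard \<sigma> + 1 + snd x)", OF fin1 fin2] by simp
    have time: "real (cost guard \<sigma> + 1 + snd x) \<le> T" if "x \<in> set_pmf q1" for x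
      using q1(2)[OF that] Suc.prems(1) cost_le[of L \<sigma> guard] unfolding T_def holds_def
      by (intro of_nat_mono) linarith
    show ?thesis
    proof (intro exI[of _ ?q] conjI impI allI, rule ex)
      show "\<forall>x \<in> set_pmf ?q. answers_yes (fst x) \<longrightarrow> yes"
      proof -
        have "answers_yes (fst y) \<longrightarrow> yes" if "x \<in> set_pmf q1" "y \<in> set_pmf (q2 (fst x))" for x y
          using q2 that unfolding \<phi>_def by blast
        then show ?thesis by (fastforce simp: set_pmf_delay)
      qed
    next
      assume yes
      have "probably attempt (1 * p) (\<lambda>\<tau>. \<tau> ''out'' 0 \<noteq> 0) \<sigma>"
        unfolding attempt_def
      proof (rule probably_Seq)
        show "probably (''cap'' ::= scalar ''cap'' [-] Const 1) 1 (\<lambda>\<tau>. \<tau> = \<sigma>1) \<sigma>"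
          by (intro probably_Store) (rule \<sigma>1_eq)
      qed (use hit[OF \<open>yes\<close> \<sigma>1(1,2)] p in simp_all)
      then have "p \<le> expect q1 (\<lambda>x. of_bool (fst x ''out'' 0 \<noteq> 0))"
        using q1(1) by (simp add: probably_def)
      moreover have "expect q1 (\<lambda>x. of_bool (fst x ''out'' 0 = 0)) =
          expect q1 (\<lambda>x. 1 + of_bool (fst x ''out'' 0 \<noteq> 0) * (- 1))"
        by (intro Bochner_Integration.integral_cong) auto
      ultimately have miss: "expect q1 (\<lambda>x. of_bool (fst x ''out'' 0 = 0)) \<le> 1 - p"
        unfolding expect_linear[OF fin1] by simp
      \<comment> \<open>The recursion common to all three estimates: \<open>u\<close> is paid in any
        case, and a further \<open>b\<close> only if the attempt fails, which has probability at
        most \<open>1 - p\<close>.\<close>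
      have bound: "expect ?q f \<le> u + (1 - p) * b"
        if "0 \<le> b" "\<And>x. x \<in> set_pmf q1 \<Longrightarrow>
          expect (q2 (fst x)) (\<lambda>y. f (fst y, cost guard \<sigma> + 1 + (snd x + snd y))) \<le>
            u + of_bool (fst x ''out'' 0 = 0) * b" for f u b
      proof -
        have "expect ?q f \<le> expect q1 (\<lambda>x. u + of_bool (fst x ''out'' 0 = 0) * b)"
          unfolding expect_q using fin1 that(2) by (rule expect_mono)
        also have "\<dots> = u + expect q1 (\<lambda>x. of_bool (fst x ''out'' 0 = 0)) * b"
          by (rule expect_linear[OF fin1])
        also have "\<dots> \<le> u + (1 - p) * b" using miss that(1) by (intro add_left_mono mult_right_mono)
        finally show ?thesis .
      qed
      have \<phi>: "expect (q2 (fst x)) (\<lambda>x. of_bool (\<not> answers_yes (fst x))) \<le> of_bool (fst x ''out'' 0 = 0) * (1 - p) ^ c"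
          "expect (q2 (fst x)) (\<lambda>x. real (snd x)) \<le> e + of_bool (fst x ''out'' 0 = 0) * (T / p)"
          "\<And>j. expect (q2 (fst x)) (\<lambda>x. of_bool (real (snd x) > e + T * real j)) \<le>
            of_bool (fst x ''out'' 0 = 0) * (1 - p) ^ j"
        if "x \<in> set_pmf q1" for x
        using q2 that \<open>yes\<close> unfolding \<phi>_def by blast+
      have "expect ?q (\<lambda>x. of_bool (\<not> answers_yes (fst x))) \<le> 0 + (1 - p) * (1 - p) ^ c"
        using \<phi>(1) p by (intro bound) simp_all
      then show "expect ?q (\<lambda>x. of_bool (\<not> answers_yes (fst x))) \<le> of_bool (\<sigma> ''out'' 0 = 0) * (1 - p) ^ Suc c"
        using True by simp
      \<comment> \<open>One guard evaluation and one attempt take at most \<open>T\<close>, the last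
        guard evaluation at most \<open>e\<close>; \<open>T / p\<close> solves
        \<open>x = T + (1 - p) * x\<close>.\<close>
      have "expect ?q (\<lambda>x. real (snd x)) \<le> (T + e) + (1 - p) * (T / p)"
      proof (rule bound)
        fix x assume x: "x \<in> set_pmf q1"
        have "expect (q2 (fst x)) (\<lambda>y. real (snd (fst y, cost guard \<sigma> + 1 + (snd x + snd y)))) =
            expect (q2 (fst x)) (\<lambda>y. real (cost guard \<sigma> + 1 + snd x) + real (snd y) * 1)"
          by (simp add: algebra_simps)
        also have "\<dots> = real (cost guard \<sigma> + 1 + snd x) + expect (q2 (fst x)) (\<lambda>y. real (snd y)) * 1"
          by (rule expect_linear[OF fin2[OF x]])
        also have "\<dots> \<le> T + e + of_bool (fst x ''out'' 0 = 0) * (T / p)"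
          using time[OF x] \<phi>(2)[OF x] by linarith
        finally show "expect (q2 (fst x)) (\<lambda>y. real (snd (fst y, cost guard \<sigma> + 1 + (snd x + snd y)))) \<le>
            T + e + of_bool (fst x ''out'' 0 = 0) * (T / p)" .
      qed (use T p in simp)
      also have "\<dots> = e + T / p" using p by (simp add: field_simps)
      finally show "expect ?q (\<lambda>x. real (snd x)) \<le> e + of_bool (\<sigma> ''out'' 0 = 0) * (T / p)"
        using True by simp
      fix j
      show "expect ?q (\<lambda>x. of_bool (real (snd x) > e + T * real j)) \<le> of_bool (\<sigma> ''out'' 0 = 0) * (1 - p) ^ j"
      proof (cases j)
        case 0
        have "expect ?q (\<lambda>x. of_bool (real (snd x) > e + T * real j)) \<le> expect ?q (\<lambda>x. 1)"
          using exec_finite_support[OF ex] by (intro expect_mono) auto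
        then show ?thesis using True 0 by simp
      next
        case (Suc i)
        \<comment> \<open>The first attempt takes at most \<open>T\<close>, so exceeding the bound
          for \<open>Suc i\<close> means that the remaining run exceeds the bound for
          \<open>i\<close>. After a success this has probability 0, hence \<open>u = 0\<close>
          here.\<close>
        have "expect ?q (\<lambda>x. of_bool (real (snd x) > e + T * real j)) \<le> 0 + (1 - p) * (1 - p) ^ i"
        proof (rule bound)
          fix x assume x: "x \<in> set_pmf q1"
          have "expect (q2 (fst x)) (\<lambda>y. of_bool
                (e + T * real j < real (snd (fst y, cost guard \<sigma> + 1 + (snd x + snd y))))) \<le>
              expect (q2 (fst x)) (\<lambda>y. of_bool (real (snd y) > e + T * real i))"
            using time[OF x] fin2[OF x] by (intro expect_mono) (auto simp: Suc algebra_simps)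
          then show "expect (q2 (fst x)) (\<lambda>y. of_bool
                (e + T * real j < real (snd (fst y, cost guard \<sigma> + 1 + (snd x + snd y))))) \<le>
              0 + of_bool (fst x ''out'' 0 = 0) * (1 - p) ^ i"
            using \<phi>(3)[OF x, of i] by linarith
        qed (use p in simp)
        then show ?thesis using True Suc by simp
      qed
    qed
  qed
qed


section \<open>Time and error bounds\<close>

lemma wp_set_cap:
  assumes n: "\<sigma> ''n'' 0 = n" and k: "\<sigma> ''k'' 0 = k"
  shows "wp (word_size n k) set_cap (\<lambda>\<tau>. \<tau> ''cap'' 0 = n * 2 ^ (n + k)) \<sigma>"
proof -
  have "n * 2 ^ (n + k) < (2 :: nat) ^ n * 2 ^ (n + k)" by (simp add: less_exp)
  also have "\<dots> = 2 ^ (2 * n + k)" by (simp add: mult_2 add.assoc flip: power_add)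
  also have "\<dots> < 2 ^ word_size n k" by (intro power_strict_increasing) (simp_all add: word_size_def)
  finally have bound: "n * 2 ^ (n + k) < 2 ^ word_size n k" .
  define I where "I i \<tau> \<longleftrightarrow> \<tau> ''cap'' 0 = 2 ^ i" for i and \<tau> :: state
  show ?thesis
    unfolding set_cap_def
  proof (intro wp_Seq wp_Store, goal_cases)
    case 1
    then show ?case using one_less_power[of "2 :: nat" "word_size n k"] by simp
  next
    case 2
    show ?case
    proof (rule wp_For[where N = "n + k" and I = I], goal_cases)
      case 1
      then show ?case by (simp add: I_def update_def)
    next
      case (2 i \<tau>)
      have "(2 :: nat) ^ Suc i < 2 ^ word_size n k"
        using 2(1) by (intro power_strict_increasing) (simp_all add: word_size_def)
      then show ?case using 2(2) by (intro wp_Store) (simp_all add: I_def update_def)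
    next
      case (3 \<tau>)
      then show ?case using n k 3[of "''n''"] 3[of "''k''"] by (simp add: update_def)
    next
      case (7 \<tau>)
      have "\<tau> ''n'' 0 = n" using 7(2)[of "''n''"] n by (simp add: update_def)
      then show ?case using 7(1) bound
        by (intro wp_Store) (simp_all add: I_def update_def mult.commute)
    qed (use linear_bounds[of n k] in simp_all)
  qed
qed

lemma probably_le: "probably c a Q \<sigma> \<Longrightarrow> b \<le> a \<Longrightarrow> probably c b Q \<sigma>"
  unfolding probably_def by (meson order_trans)

text \<open>From \<open>1 - x \<le> exp (- x)\<close>. It is applied twice, with \<open>N\<close>
  the cap for the error and with \<open>N = n * 2 ^ m\<close> for the tail of the time.\<close>

lemma power_one_minus_le_exp:
  assumes "real n * 2 ^ m \<le> real N"
  shows "(1 - (1 / 2) ^ m) ^ N \<le> exp (-1 :: real) ^ n"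
proof -
  have p: "(0 :: real) < (1 / 2) ^ m" "(1 / 2 :: real) ^ m \<le> 1" by (simp_all add: power_le_one)
  have "1 - (1 / 2) ^ m \<le> exp (- ((1 / 2 :: real) ^ m))"
    using exp_ge_add_one_self[of "- ((1 / 2 :: real) ^ m)"] by simp
  then have "(1 - (1 / 2 :: real) ^ m) ^ N \<le> exp (- ((1 / 2) ^ m)) ^ N"
    using p by (intro power_mono) simp_all
  also have "\<dots> = exp (- (real N * (1 / 2) ^ m))" by (simp flip: exp_of_nat_mult)
  also have "\<dots> \<le> exp (- real n)" using assms by (simp add: field_simps)
  also have "\<dots> = exp (-1) ^ n" by (simp flip: exp_of_nat_mult)
  finally show ?thesis .
qed

text \<open>For an out-branching \<open>T\<close> attaining the minimum, \<open>D\<close> consists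
  of \<open>k\<close> chosen leaves \<open>K\<close> and the vertices of out-degree greater than 1.
  Agreement of \<open>X\<close> with \<open>K\<close> on \<open>D\<close> says that \<open>X\<close>
  contains the former and avoids the latter. Fixing only \<open>k\<close> leaves, not all of them,
  keeps \<open>D\<close> small.\<close>

lemma k_leaf_instance_never_rejects:
  assumes G: "pair_digraph G" "pverts G = {..<n}" and yes: "k_leaf_instance k (with_proj G)"
  obtains K D where "D \<subseteq> {..<n}" "card D \<le> k + min_branching k (with_proj G)"
    "\<forall>X \<subseteq> {..<n}. X \<inter> D = K \<inter> D \<longrightarrow> (\<exists>r < n. never_rejects n k (parcs G) X r)"
    "k \<le> n" "min_branching k (with_proj G) \<le> n"
proof -
  let ?s = "min_branching k (with_proj G)"
  \<comment> \<open>On a yes-instance the set is nonempty, so the infimum is attained.\<close>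
  have "?s \<in> (\<lambda>T. card (branching_verts T)) ` k_leaf_out_branchings k (with_proj G)"
    unfolding min_branching_def branching_verts_def
    by (rule Inf_nat_def1) (use yes in \<open>simp add: k_leaf_instance_def\<close>)
  then obtain T where T: "T \<in> k_leaf_out_branchings k (with_proj G)" "?s = card (branching_verts T)"
    by blast
  have verts: "verts T = {..<n}" and leaves: "k \<le> card (leaves T)"
    using T(1) G(2) by (auto simp: k_leaf_out_branchings_def spanning_def)
  obtain K where K: "K \<subseteq> leaves T" "card K = k"
    using obtain_subset_with_card_n[OF leaves] by metis
  have sub: "leaves T \<subseteq> {..<n}" "branching_verts T \<subseteq> {..<n}" "leaves T \<inter> branching_verts T = {}"
    using verts by (auto simp: leaves_def branching_verts_def internal_verts_def)
  have "k \<le> n" "?s \<le> n"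
    using card_mono[OF _ sub(1)] card_mono[OF _ sub(2)] leaves T(2) by simp_all
  moreover have "\<exists>r < n. never_rejects n k (parcs G) X r"
    if "X \<subseteq> {..<n}" "X \<inter> (K \<union> branching_verts T) = K \<inter> (K \<union> branching_verts T)" for X
  proof -
    have X: "K \<subseteq> X" "X \<inter> branching_verts T = {}" using that(2) K(1) sub(3) by blast+
    have "X \<subseteq> pverts G" using that(1) G(2) by simp
    then obtain r where r: "r \<in> pverts G" "\<forall>S0 S m. cut_sequence (pverts G) (parcs G) r S0 S m \<longrightarrow>
        {(a, b) \<in> parcs G. a \<notin> X} \<subseteq> S0 \<longrightarrow> k + m \<le> card X"
      using k_leaf_instanceE[OF G(1) T(1) K X(1) _ X(2)] by blast
    have "never_rejects n k (parcs G) X r"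
      unfolding never_rejects_def
    proof (intro allI impI)
      fix S m assume "cut_sequence {..<n} (parcs G) r (start_relation n (parcs G) X) S m"
      moreover have "{(a, b) \<in> parcs G. a \<notin> X} \<subseteq> start_relation n (parcs G) X"
        by (auto simp: start_relation_def)
      ultimately show "k + m \<le> card X"
        using r(2)[rule_format, of "start_relation n (parcs G) X" S m] G(2) by simp
    qed
    then show ?thesis using r(1) G(2) by auto
  qed
  moreover have "card (K \<union> branching_verts T) \<le> k + ?s"
    using card_Un_le[of K "branching_verts T"] K(2) T(2) by simp
  moreover have "K \<union> branching_verts T \<subseteq> {..<n}" using K(1) sub by blast
  ultimately show ?thesis using that[of "K \<union> branching_verts T" K] by blast
qed

lemma accepts_imp_k_leaf_instance:
  assumes "pair_digraph G" "pverts G = {..<n}" "X \<subseteq> {..<n}" "r < n" "accepts n k (parcs G) X r"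
  shows "k_leaf_instance k (with_proj G)"
proof -
  obtain S m where "cut_sequence (pverts G) (parcs G) r (start_relation n (parcs G) X) S m"
    "\<forall>w \<in> pverts G. (r, w) \<in> S\<^sup>*" "k + m \<le> card X"
    using assms(2,5) unfolding accepts_def by auto
  then show ?thesis
    using assms by (intro k_leaf_instanceI[where X = X and r = r]) (auto simp: start_relation_def)
qed

text \<open>\<open>u\<close> covers the computation of the cap and the final guard evaluation,
  \<open>T\<close> one round of the main loop. An attempt succeeds with probability at least
  \<open>1 / 2 ^ m\<close>; after \<open>n * 2 ^ m\<close> rounds a failure has probability at most
  \<open>exp (- n)\<close>.\<close>

lemma algorithm_bounds:
  fixes n k :: nat and G :: "nat pair_pre_digraph"
  assumes G: "pair_digraph G" "pverts G = {..<n}"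
  defines "L \<equiv> word_size n k" and "yes \<equiv> k_leaf_instance k (with_proj G)"
    and "m \<equiv> k + min_branching k (with_proj G)"
  defines "T \<equiv> cost_bound guard L + 1 + time_bound attempt L"
    and "u \<equiv> time_bound set_cap L + cost_bound guard L + 1"
  shows "\<exists>p. exec algorithm (input_state n k G) p \<and> (\<forall>x \<in> set_pmf p. answers_yes (fst x) \<longrightarrow> yes) \<and>
    (yes \<longrightarrow>
      expect p (\<lambda>x. of_bool (\<not> answers_yes (fst x))) \<le> exp (-1) ^ n \<and>
      expect p (\<lambda>x. real (snd x)) \<le> real (u + T * 2 ^ m) \<and>
      expect p (\<lambda>x. of_bool (snd x > u + T * (n * 2 ^ m))) \<le> exp (-1) ^ n)"
proof -
  interpret G: pair_digraph G by fact
  interpret inst: instance_state n k "parcs G" "word_size n k"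
    using G.wellformed' G(2) by unfold_locales auto
  define p :: real where "p = (1 / 2) ^ m"
  have p: "0 < p" "p \<le> 1" by (simp_all add: p_def power_le_one)
  have hit: "probably trial p (\<lambda>\<tau>. \<tau> ''out'' 0 \<noteq> 0) \<sigma>"
    if yes and \<sigma>: "inst.holds \<sigma>" "\<sigma> ''out'' 0 = 0" for \<sigma>
  proof -
    obtain K D where D: "D \<subseteq> {..<n}" "card D \<le> k + min_branching k (with_proj G)"
      "\<forall>X \<subseteq> {..<n}. X \<inter> D = K \<inter> D \<longrightarrow> (\<exists>r < n. never_rejects n k (parcs G) X r)"
      by (rule k_leaf_instance_never_rejects[OF G \<open>yes\<close>[unfolded yes_def]])
    have "probably trial ((1 / 2) ^ card D) (\<lambda>\<tau>. \<tau> ''out'' 0 \<noteq> 0) \<sigma>"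
      using \<sigma> D(1) D(3)[rule_format] by (rule inst.probably_trial)
    then show ?thesis using D(2) by (elim probably_le) (simp add: p_def m_def power_decreasing)
  qed
  have sound: "yes" if "X \<subseteq> {..<n}" "r < n" "accepts n k (parcs G) X r" for X r
    using accepts_imp_k_leaf_instance[OF G that] by (simp add: yes_def)
  define \<sigma> where "\<sigma> = input_state n k G"
  have "n < 2 ^ word_size n k" "k < 2 ^ word_size n k" "1 < (2 :: nat) ^ word_size n k"
    using linear_bounds(1)[of n k] by simp_all
  then have \<sigma>: "inst.holds \<sigma>" "\<sigma> ''out'' 0 = 0"
    by (auto simp: \<sigma>_def input_state_def inst.holds_def bounded_state_def input_cell_def)
  define c where "c = n * 2 ^ (n + k)"
  have "wp L set_cap (\<lambda>\<tau>. \<tau> ''cap'' 0 = c) \<sigma>" "bounded_state L \<sigma>"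
    using wp_set_cap[of \<sigma> n k] \<sigma>(1) by (simp_all add: inst.holds_def c_def L_def)
  from wpE[OF this] obtain q0 where q0: "exec set_cap \<sigma> q0"
    "\<And>x. x \<in> set_pmf q0 \<Longrightarrow> bounded_state L (fst x) \<and> fst x ''cap'' 0 = c \<and> snd x \<le> time_bound set_cap L"
    by blast
  have fin0: "finite (set_pmf q0)" by (rule exec_finite_support[OF q0(1)])
  have after: "inst.holds (fst x)" "fst x ''cap'' 0 = c" "fst x ''out'' 0 = 0" if "x \<in> set_pmf q0" for x
    using exec_unwritten[OF q0(1) that, of "''n''"] exec_unwritten[OF q0(1) that, of "''k''"]
      exec_unwritten[OF q0(1) that, of "''A''"] exec_unwritten[OF q0(1) that, of "''out''"]
      q0(2)[OF that] \<sigma> by (simp_all add: set_cap_def inst.holds_def L_def)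
  define e where "e = real (cost_bound guard L + 1)"
  define \<phi> where "\<phi> q \<longleftrightarrow> (\<forall>x \<in> set_pmf q. answers_yes (fst x) \<longrightarrow> yes) \<and>
    (yes \<longrightarrow>
      expect q (\<lambda>x. of_bool (\<not> answers_yes (fst x))) \<le> (1 - p) ^ c \<and>
      expect q (\<lambda>x. real (snd x)) \<le> e + real T / p \<and>
      (\<forall>j. expect q (\<lambda>x. of_bool (real (snd x) > e + real T * real j)) \<le> (1 - p) ^ j))"
    for q :: "(state \<times> nat) pmf"
  have "\<forall>x \<in> set_pmf q0. \<exists>q. exec (While guard attempt) (fst x) q \<and> \<phi> q"
  proof
    fix x assume x: "x \<in> set_pmf q0"
    show "\<exists>q. exec (While guard attempt) (fst x) q \<and> \<phi> q"
    proof -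
      have out: "fst x ''out'' 0 \<noteq> 0 \<longrightarrow> yes" using after(3)[OF x] by simp
      show ?thesis
        using inst.main_loop[where yes = yes and p = p and \<sigma> = "fst x" and c = c,
          OF sound p hit after(1)[OF x] after(2)[OF x] out]
        unfolding \<phi>_def e_def T_def L_def
        by (simp only: after(3)[OF x] of_bool_eq mult_1 simp_thms)
    qed
  qed
  then obtain q where q: "\<forall>x \<in> set_pmf q0. exec (While guard attempt) (fst x) (q (fst x)) \<and> \<phi> (q (fst x))"
    by (rule exec_choice)
  have fin: "finite (set_pmf (q (fst x)))" if "x \<in> set_pmf q0" for x
    using q that exec_finite_support by blast
  let ?p = "bind_pmf q0 (\<lambda>(\<sigma>', t). delay t (q \<sigma>'))"
  have bound: "expect ?p f \<le> b"
    if "\<And>x. x \<in> set_pmf q0 \<Longrightarrow> expect (q (fst x)) (\<lambda>y. f (fst y, snd x + snd y)) \<le> b" for f b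
  proof -
    have "expect ?p f = expect q0 (\<lambda>x. expect (q (fst x)) (\<lambda>y. f (fst y, snd x + snd y)))"
      by (rule expect_sequence[of q0 q f, OF fin0 fin])
    also have "\<dots> \<le> expect q0 (\<lambda>x. b)" using fin0 that by (rule expect_mono)
    finally show ?thesis by simp
  qed
  show ?thesis
  proof (intro exI[of _ ?p] conjI impI)
    show "exec algorithm (input_state n k G) ?p"
      unfolding algorithm_def \<sigma>_def[symmetric] using q0(1) q by (intro exec.Seq) simp_all
    show "\<forall>x \<in> set_pmf ?p. answers_yes (fst x) \<longrightarrow> yes"
    proof -
      have "answers_yes (fst y) \<longrightarrow> yes" if "x \<in> set_pmf q0" "y \<in> set_pmf (q (fst x))" for x y
        using q that unfolding \<phi>_def by blast
      then show ?thesis by (fastforce simp: set_pmf_delay)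
    qed
  next
    assume yes
    then have \<phi>: "expect (q (fst x)) (\<lambda>x. of_bool (\<not> answers_yes (fst x))) \<le> (1 - p) ^ c"
      "expect (q (fst x)) (\<lambda>x. real (snd x)) \<le> e + real T / p"
      "\<And>j. expect (q (fst x)) (\<lambda>x. of_bool (real (snd x) > e + real T * real j)) \<le> (1 - p) ^ j"
      if "x \<in> set_pmf q0" for x
      using q that unfolding \<phi>_def by blast+
    have "min_branching k (with_proj G) \<le> n"
      using k_leaf_instance_never_rejects[OF G \<open>yes\<close>[unfolded yes_def]] by blast
    \<comment> \<open>The cap was computed with \<open>n\<close> in place of the number of branching
      vertices, so it allows at least the rounds that the estimate needs.\<close>
    then have "n * 2 ^ m \<le> c" unfolding c_def m_def by (intro mult_left_mono power_increasing) auto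
    then have "real n * 2 ^ m \<le> real c" by (metis of_nat_le_iff of_nat_mult of_nat_numeral of_nat_power)
    then have small: "(1 - p) ^ c \<le> exp (-1) ^ n" "(1 - p) ^ (n * 2 ^ m) \<le> exp (-1) ^ n"
      unfolding p_def by (intro power_one_minus_le_exp; simp)+
    show "expect ?p (\<lambda>x. of_bool (\<not> answers_yes (fst x))) \<le> exp (-1) ^ n"
      using \<phi>(1) small(1) by (intro bound) fastforce
    have "real T / p = real T * 2 ^ m" by (simp add: p_def power_divide)
    have first: "real (snd x) \<le> real (time_bound set_cap L)" if "x \<in> set_pmf q0" for x
      using q0(2)[OF that] by simp
    show "expect ?p (\<lambda>x. real (snd x)) \<le> real (u + T * 2 ^ m)"
    proof (rule bound)
      fix x assume x: "x \<in> set_pmf q0"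
      have "expect (q (fst x)) (\<lambda>y. real (snd (fst y, snd x + snd y))) =
          real (snd x) + expect (q (fst x)) (\<lambda>y. real (snd y)) * 1"
        using expect_linear[OF fin[OF x], of "real (snd x)" "\<lambda>y. real (snd y)" 1] by simp
      then show "expect (q (fst x)) (\<lambda>y. real (snd (fst y, snd x + snd y))) \<le> real (u + T * 2 ^ m)"
        using \<phi>(2)[OF x] first[OF x] \<open>real T / p = _\<close> by (simp add: u_def e_def)
    qed
    show "expect ?p (\<lambda>x. of_bool (snd x > u + T * (n * 2 ^ m))) \<le> exp (-1) ^ n"
    proof (rule bound)
      fix x assume x: "x \<in> set_pmf q0"
      have "expect (q (fst x)) (\<lambda>y. of_bool (u + T * (n * 2 ^ m) < snd (fst y, snd x + snd y))) \<le>
          expect (q (fst x)) (\<lambda>y. of_bool (real (snd y) > e + real T * real (n * 2 ^ m)))"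
      proof (rule expect_mono[OF fin[OF x]])
        fix y
        have "e + real T * real (n * 2 ^ m) < real (snd y)" if "u + T * (n * 2 ^ m) < snd x + snd y"
        proof -
          have "cost_bound guard L + 1 + T * (n * 2 ^ m) < snd y"
            using that q0(2)[OF x] by (simp add: u_def)
          then have "real (cost_bound guard L + 1 + T * (n * 2 ^ m)) < real (snd y)"
            by (simp only: of_nat_less_iff)
          then show ?thesis by (simp add: e_def)
        qed
        then show "of_bool (u + T * (n * 2 ^ m) < snd (fst y, snd x + snd y)) \<le>
            (of_bool (real (snd y) > e + real T * real (n * 2 ^ m)) :: real)" by auto
      qed
      then show "expect (q (fst x)) (\<lambda>y. of_bool (u + T * (n * 2 ^ m) < snd (fst y, snd x + snd y))) \<le> exp (-1) ^ n"
        using \<phi>(3)[OF x, of "n * 2 ^ m"] small(2) by linarith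
    qed
  qed
qed

theorem theorem6:
  shows "\<exists>(c :: com) (Q :: nat poly) (\<epsilon> :: nat \<Rightarrow> real).
    \<epsilon> \<longlonglongrightarrow> 0 \<and>
    (\<forall>(n :: nat) (k :: nat) (G :: nat pair_pre_digraph).
       pair_digraph G \<and> pverts G = {..<n} \<longrightarrow>
       (\<exists>p. exec c (input_state n k G) p \<and>
          (\<not> k_leaf_instance k (with_proj G) \<longrightarrow>
             (\<forall>(\<sigma>, t) \<in> set_pmf p. \<not> answers_yes \<sigma>)) \<and>
          (k_leaf_instance k (with_proj G) \<longrightarrow>
             (let B = poly Q (input_size n k) * 2 ^ (k + min_branching k (with_proj G)) in
                measure_pmf.prob p {(\<sigma>, t). \<not> answers_yes \<sigma>} \<le> \<epsilon> n \<and>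
                measure_pmf.expectation p (\<lambda>(\<sigma>, t). real t) \<le> real B \<and>
                measure_pmf.prob p {(\<sigma>, t). t > B} \<le> \<epsilon> n))))"
proof -
  define u where "u L = time_bound set_cap L + cost_bound guard L + 1" for L
  define T where "T L = cost_bound guard L + 1 + time_bound attempt L" for L
  \<comment> \<open>The factor \<open>L + 1\<close> absorbs the factor \<open>n\<close> of the tail
    bound, so one polynomial serves for the expectation and for the tail.\<close>
  have "poly_bounded (\<lambda>L. u L + T L * (L + 1))"
    unfolding u_def T_def
    by (intro poly_bounded_intros poly_bounded_time_bound poly_bounded_cost_bound)
  then obtain Q :: "nat poly" where Q: "\<forall>L x. L \<le> 6 * x + 3 \<longrightarrow> u L + T L * (L + 1) \<le> poly Q x"
    using poly_bounded_compose_linear[where a = 6 and b = 3] by blast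
  show ?thesis
  proof (intro exI[of _ algorithm] exI[of _ Q] exI[of _ "\<lambda>n. exp (-1) ^ n"] conjI allI impI)
    show "(\<lambda>n. exp (-1 :: real) ^ n) \<longlonglongrightarrow> 0" by (rule LIMSEQ_power_zero) simp
    fix n k and G :: "nat pair_pre_digraph"
    assume G: "pair_digraph G \<and> pverts G = {..<n}"
    let ?G = "with_proj G"
    let ?L = "word_size n k" and ?m = "k + min_branching k ?G"
    obtain p where p: "exec algorithm (input_state n k G) p"
      "\<forall>x \<in> set_pmf p. answers_yes (fst x) \<longrightarrow> k_leaf_instance k ?G"
      "k_leaf_instance k ?G \<Longrightarrow>
        expect p (\<lambda>x. of_bool (\<not> answers_yes (fst x))) \<le> exp (-1) ^ n \<and>
        expect p (\<lambda>x. real (snd x)) \<le> real (u ?L + T ?L * 2 ^ ?m) \<and>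
        expect p (\<lambda>x. of_bool (snd x > u ?L + T ?L * (n * 2 ^ ?m))) \<le> exp (-1) ^ n"
      using algorithm_bounds[of G n k] G unfolding u_def T_def by blast
    define B where "B = poly Q (input_size n k) * 2 ^ ?m"
    have "measure_pmf.prob p {(\<sigma>, t). \<not> answers_yes \<sigma>} \<le> exp (-1) ^ n \<and>
        measure_pmf.expectation p (\<lambda>(\<sigma>, t). real t) \<le> real B \<and>
        measure_pmf.prob p {(\<sigma>, t). t > B} \<le> exp (-1) ^ n" if yes: "k_leaf_instance k ?G"
    proof -
      have "k \<le> n" using k_leaf_instance_never_rejects[OF conjunct1[OF G] conjunct2[OF G] yes] by blast
      \<comment> \<open>On a yes-instance \<open>k \<le> n\<close>, so the word length
        \<open>5 * n + k + 3\<close> is at most \<open>6 * n + 3\<close>; as \<open>n * n\<close> is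
        part of the input size, this gives the constants 6 and 3 chosen for
        \<open>Q\<close>.\<close>
      have "?L \<le> 6 * (n * n) + 3"
        using \<open>k \<le> n\<close> le_square[of n] unfolding word_size_def by linarith
      then have "u ?L + T ?L * (?L + 1) \<le> poly Q (input_size n k)"
        using Q by (simp add: input_size_def)
      then have "(u ?L + T ?L * (?L + 1)) * 2 ^ ?m \<le> B" unfolding B_def by (rule mult_right_mono) simp
      moreover have "u ?L \<le> u ?L * 2 ^ ?m" by simp
      moreover have "T ?L * (1 * 2 ^ ?m) \<le> T ?L * ((?L + 1) * 2 ^ ?m)"
        "T ?L * (n * 2 ^ ?m) \<le> T ?L * ((?L + 1) * 2 ^ ?m)"
        by (intro mult_left_mono mult_right_mono; simp add: word_size_def)+
      ultimately have B: "u ?L + T ?L * 2 ^ ?m \<le> B" "u ?L + T ?L * (n * 2 ^ ?m) \<le> B"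
        by (simp_all only: add_mult_distrib mult.assoc mult_1)
      have fin: "finite (set_pmf p)" by (rule exec_finite_support[OF p(1)])
      have "measure_pmf.prob p {(\<sigma>, t). \<not> answers_yes \<sigma>} = expect p (\<lambda>x. of_bool (\<not> answers_yes (fst x)))"
        unfolding prob_eq_expect[symmetric] by (intro arg_cong[where f = "measure_pmf.prob p"]) auto
      moreover have "measure_pmf.expectation p (\<lambda>(\<sigma>, t). real t) = expect p (\<lambda>x. real (snd x))"
        by (intro arg_cong[where f = "expect p"]) auto
      moreover have "measure_pmf.prob p {(\<sigma>, t). t > B} = expect p (\<lambda>x. of_bool (snd x > B))"
        unfolding prob_eq_expect[symmetric] by (intro arg_cong[where f = "measure_pmf.prob p"]) auto
      moreover have "expect p (\<lambda>x. of_bool (snd x > B)) \<le>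
          expect p (\<lambda>x. of_bool (snd x > u ?L + T ?L * (n * 2 ^ ?m)))"
        using B(2) by (intro expect_mono[OF fin]) auto
      moreover have "real (u ?L + T ?L * 2 ^ ?m) \<le> real B" using B(1) by (rule of_nat_mono)
      ultimately show ?thesis using p(3)[OF yes] by linarith
    qed
    moreover have "\<forall>(\<sigma>, t) \<in> set_pmf p. \<not> answers_yes \<sigma>" if "\<not> k_leaf_instance k ?G"
      using p(2) that by fastforce
    ultimately show "\<exists>p. exec algorithm (input_state n k G) p \<and>
          (\<not> k_leaf_instance k ?G \<longrightarrow> (\<forall>(\<sigma>, t) \<in> set_pmf p. \<not> answers_yes \<sigma>)) \<and>
          (k_leaf_instance k ?G \<longrightarrow>
             (let B = poly Q (input_size n k) * 2 ^ ?m in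
                measure_pmf.prob p {(\<sigma>, t). \<not> answers_yes \<sigma>} \<le> exp (-1) ^ n \<and>
                measure_pmf.expectation p (\<lambda>(\<sigma>, t). real t) \<le> real B \<and>
                measure_pmf.prob p {(\<sigma>, t). t > B} \<le> exp (-1) ^ n))"
      using p(1) unfolding B_def Let_def by (intro exI[of _ p]) simp
  qed
qed

end
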